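(* For every $n\ge 2$, there is a fixed rational subset of the wreath product $\mathbb Z/n\mathbb Z\wr(\mathbb Z\times\mathbb Z)$ whose membership problem is undecidable.
   Context: $\mathbb Z/n\mathbb Z\wr(\mathbb Z\times\mathbb Z)$ is the semidirect product $(\mathbb Z/n\mathbb Z)[\mathbb Z\times\mathbb Z]\rtimes(\mathbb Z\times\mathbb Z)$ with $\mathbb Z\times\mathbb Z$ acting on the group ring by left multiplication. For a group $H$ with finite generating set $\Delta$ and canonical map $\pi:(\Delta\cup\Delta^{-1})^*\to H$, a rational subset is a set $\pi(L)$ with $L$ a regular language over $\Delta\cup\Delta^{-1}$; its membership problem asks, given a word $w$, whether $\pi(w)\in\pi(L)$. *)

theory Defs
  imports Main
begin

datatype recf = Zf | Sf | Proj nat | Comp recf "recf list" | Prim recf recf | Mn recf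

inductive reval :: "recf \<Rightarrow> nat list \<Rightarrow> nat \<Rightarrow> bool" where
  zero: "reval Zf xs 0"
| succ: "reval Sf (x # xs) (Suc x)"
| proj: "i < length xs \<Longrightarrow> reval (Proj i) xs (xs ! i)"
| comp: "list_all2 (\<lambda>g v. reval g xs v) gs vs \<Longrightarrow> reval f vs y \<Longrightarrow> reval (Comp f gs) xs y"
| prim0: "reval f xs y \<Longrightarrow> reval (Prim f g) (0 # xs) y"
| primS: "reval (Prim f g) (k # xs) r \<Longrightarrow> reval g (r # k # xs) y \<Longrightarrow> reval (Prim f g) (Suc k # xs) y"
| mn: "reval f (y # xs) 0 \<Longrightarrow> (\<forall>z<y. \<exists>v. reval f (z # xs) v \<and> v > 0) \<Longrightarrow> reval (Mn f) xs y"

definition decidable_set :: "nat set \<Rightarrow> bool" where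
  "decidable_set A \<longleftrightarrow> (\<exists>f. \<forall>x. reval f [x] (if x \<in> A then 1 else 0))"

datatype 'a rexp = RZero | ROne | RAtom 'a | RPlus "'a rexp" "'a rexp" | RTimes "'a rexp" "'a rexp" | RStar "'a rexp"

fun lang :: "'a rexp \<Rightarrow> 'a list set" where
  "lang RZero = {}"
| "lang ROne = {[]}"
| "lang (RAtom a) = {[a]}"
| "lang (RPlus r s) = lang r \<union> lang s"
| "lang (RTimes r s) = {u @ v | u v. u \<in> lang r \<and> v \<in> lang s}"
| "lang (RStar r) = {concat ws | ws. \<forall>w\<in>set ws. w \<in> lang r}"

text \<open>Letters of \<Delta> \<union> \<Delta>^-1 for \<Delta> = {a, t1, t2}: a is the lamp generator
  (delta function at the origin, trivial shift), t1, t2 the generators of Z x Z.\<close>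
datatype letter = A | Ainv | T1 | T1inv | T2 | T2inv

text \<open>Group elements: (f, p) with f : Z^2 \<Rightarrow> Z/nZ (values kept in {0..n-1}) finitely supported,
  p \<in> Z^2. Product (f,p)(g,q) = (f + p\<cdot>g, p+q) with (p\<cdot>g)(x) = g(x - p).\<close>
type_synonym welem = "((int \<times> int) \<Rightarrow> int) \<times> (int \<times> int)"

fun wstep :: "nat \<Rightarrow> welem \<Rightarrow> letter \<Rightarrow> welem" where
  "wstep n (f, p) A = (f(p := (f p + 1) mod int n), p)"
| "wstep n (f, p) Ainv = (f(p := (f p - 1) mod int n), p)"
| "wstep n (f, (x, y)) T1 = (f, (x + 1, y))"
| "wstep n (f, (x, y)) T1inv = (f, (x - 1, y))"
| "wstep n (f, (x, y)) T2 = (f, (x, y + 1))"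
| "wstep n (f, (x, y)) T2inv = (f, (x, y - 1))"

definition wr_eval :: "nat \<Rightarrow> letter list \<Rightarrow> welem" where
  "wr_eval n w = foldl (wstep n) (\<lambda>_. 0, (0, 0)) w"

section \<open>Encoding of words as natural numbers (bijective base-6 numeration)\<close>

fun letter_code :: "letter \<Rightarrow> nat" where
  "letter_code A = 0" | "letter_code Ainv = 1" | "letter_code T1 = 2"
| "letter_code T1inv = 3" | "letter_code T2 = 4" | "letter_code T2inv = 5"

fun word_code :: "letter list \<Rightarrow> nat" where
  "word_code [] = 0"
| "word_code (c # w) = Suc (letter_code c) + 6 * word_code w"

definition membership_problem :: "nat \<Rightarrow> letter rexp \<Rightarrow> nat set" where
  "membership_problem n r = {word_code w | w. wr_eval n w \<in> wr_eval n ` lang r}"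

end

theory Submission
  imports Defs
begin

text \<open>
  The rational subset simulates a fixed semi-Thue system.  A letter is a single lamp at an offset
  inside a block of \<open>k\<close> cells, so a word becomes a row of lamps.  In one sweep the automaton adds a
  guessed word to the current row and subtracts from the row above the result of rewriting it by one
  rule.  Every row but the lowest must end up dark, so consecutive guesses agree, and the target
  group element fixes the first one; since \<open>n \<ge> 2\<close>, the values 0 and 1 do not collide modulo \<open>n\<close>.

  The semi-Thue system interprets while programs that are written, together with their unary
  registers, in the word itself.  Recursive functions compile to such programs.  Only the
  implication from \<^const>\<open>reval\<close> to the run of the program is needed, because runs are
  deterministic.

  For the diagonal argument, let \<open>f\<close> decide the problem, let \<open>u\<close> write the program \<open>g\<close> and let
  \<open>x\<close> be the code of \<open>u\<close>.  The code of the word that writes \<open>x\<close> in unary followed by the program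
  is a recursive function of \<open>x\<close> alone; if \<open>g\<close> applies \<open>f\<close> to this code, then \<open>g\<close> on input \<open>x\<close>
  returns 0 both if and only if its own word is accepted and if and only if it is rejected.
\<close>

section \<open>Integer lamp configurations\<close>

fun shx :: "letter \<Rightarrow> int" where
  "shx T1 = 1" | "shx T1inv = - 1" | "shx _ = 0"

fun shy :: "letter \<Rightarrow> int" where
  "shy T2 = 1" | "shy T2inv = - 1" | "shy _ = 0"

fun wt :: "letter \<Rightarrow> int" where
  "wt A = 1" | "wt Ainv = - 1" | "wt _ = 0"

fun px :: "letter list \<Rightarrow> int" where
  "px [] = 0" | "px (c # w) = shx c + px w"

fun py :: "letter list \<Rightarrow> int" where
  "py [] = 0" | "py (c # w) = shy c + py w"

text \<open>Lamp changes are summed in the integers, relative to the start of the walk, so that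
  concatenation becomes translation plus addition. The modulus enters only when two group elements
  are compared.\<close>

fun lamp :: "letter list \<Rightarrow> int \<Rightarrow> int \<Rightarrow> int" where
  "lamp [] x y = 0"
| "lamp (c # w) x y = (if x = 0 \<and> y = 0 then wt c else 0) + lamp w (x - shx c) (y - shy c)"

lemma px_append [simp]: "px (u @ v) = px u + px v"
  by (induction u) auto

lemma py_append [simp]: "py (u @ v) = py u + py v"
  by (induction u) auto

lemma lamp_append [simp]: "lamp (u @ v) x y = lamp u x y + lamp v (x - px u) (y - py u)"
  by (induction u arbitrary: x y) (auto simp: algebra_simps)

text \<open>The starting configuration is general for the sake of the induction. It has to be
  reduced already, since \<open>wstep\<close> reduces only the cell that it changes.\<close>

lemma foldl_wstep:
  assumes "\<And>q. f q mod int n = f q"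
  shows "foldl (wstep n) (f, (a, b)) w =
    (\<lambda>(x, y). (f (x, y) + lamp w (x - a) (y - b)) mod int n, (a + px w, b + py w))"
  using assms
proof (induction w arbitrary: f a b)
  case Nil
  then show ?case by auto
next
  case (Cons c w)
  show ?case
  proof (cases c)
    case A
    show ?thesis using Cons.prems
      by (subst foldl_Cons, simp only: A wstep.simps, subst Cons.IH)
        (auto simp: fun_eq_iff mod_simps algebra_simps)
  next
    case Ainv
    show ?thesis using Cons.prems
      by (subst foldl_Cons, simp only: Ainv wstep.simps, subst Cons.IH)
        (auto simp: fun_eq_iff mod_simps algebra_simps)
  qed (use Cons in \<open>auto simp: fun_eq_iff algebra_simps\<close>)
qed

lemma wr_eval_lamp:
  "wr_eval n w = (\<lambda>(x, y). lamp w x y mod int n, (px w, py w))"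
  unfolding wr_eval_def by (subst foldl_wstep) auto

lemma wr_eval_eq_iff:
  "wr_eval n v = wr_eval n w \<longleftrightarrow>
    (\<forall>x y. lamp v x y mod int n = lamp w x y mod int n) \<and> px v = px w \<and> py v = py w"
  by (auto simp: wr_eval_lamp fun_eq_iff)

lemma walk_T1 [simp]:
  "px (replicate m T1) = int m" "py (replicate m T1) = 0" "lamp (replicate m T1) x y = 0"
  by (induction m arbitrary: x y) auto

lemma walk_T1inv [simp]:
  "px (replicate m T1inv) = - int m" "py (replicate m T1inv) = 0"
  "lamp (replicate m T1inv) x y = 0"
  by (induction m arbitrary: x y) auto

lemma walk_T2inv [simp]:
  "px (replicate m T2inv) = 0" "py (replicate m T2inv) = - int m"
  "lamp (replicate m T2inv) x y = 0"
  by (induction m arbitrary: x y) auto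

section \<open>Regular languages\<close>

definition regular :: "'a list set \<Rightarrow> bool" where
  "regular X \<longleftrightarrow> (\<exists>r. lang r = X)"

definition star :: "'a list set \<Rightarrow> 'a list set" where
  "star X = {concat ws | ws. set ws \<subseteq> X}"

definition conc :: "'a list set \<Rightarrow> 'a list set \<Rightarrow> 'a list set" where
  "conc X Y = {u @ v | u v. u \<in> X \<and> v \<in> Y}"

lemma regular_empty: "regular {}"
  unfolding regular_def by (rule exI[of _ RZero]) simp

lemma regular_conc: "regular X \<Longrightarrow> regular Y \<Longrightarrow> regular (conc X Y)"
  unfolding regular_def conc_def by (fastforce intro: exI[of _ "RTimes r s" for r s])

lemma regular_Un: "regular X \<Longrightarrow> regular Y \<Longrightarrow> regular (X \<union> Y)"
  unfolding regular_def by (fastforce intro: exI[of _ "RPlus r s" for r s])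

lemma regular_star: "regular X \<Longrightarrow> regular (star X)"
  unfolding regular_def star_def by (fastforce intro: exI[of _ "RStar r" for r])

lemma regular_single: "regular {w}"
proof (induction w)
  case Nil
  show ?case unfolding regular_def by (rule exI[of _ ROne]) simp
next
  case (Cons c w)
  have "regular {[c]}" unfolding regular_def by (rule exI[of _ "RAtom c"]) simp
  from regular_conc[OF this Cons] show ?case by (simp add: conc_def)
qed

lemma regular_UN: "finite I \<Longrightarrow> (\<And>i. i \<in> I \<Longrightarrow> regular (X i)) \<Longrightarrow> regular (\<Union>i\<in>I. X i)"
  by (induction I rule: finite_induct) (auto intro: regular_empty regular_Un)

lemma regular_finite: "finite X \<Longrightarrow> regular X"
  using regular_UN[of X "\<lambda>w. {w}"] by (simp add: regular_single)

text \<open>With \<open>f\<close> coding single letters, this makes the codes of all words the star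
  of a finite set.\<close>

lemma star_range: "star (range f) = range (\<lambda>a. concat (map f a))"
proof -
  have "\<exists>a. ws = map f a" if "set ws \<subseteq> range f" for ws
    using that by (simp add: ex_map_conv subset_iff image_iff)
  then have "star (range f) \<subseteq> range (\<lambda>a. concat (map f a))"
    unfolding star_def by blast
  moreover have "set (map f a) \<subseteq> range f" for a by auto
  then have "range (\<lambda>a. concat (map f a)) \<subseteq> star (range f)"
    unfolding star_def by blast
  ultimately show ?thesis by blast
qed

lemma star_single: "star {[c]} = range (\<lambda>m. replicate m c)"
proof -
  have "concat ws = replicate (length ws) c" if "set ws \<subseteq> {[c]}" for ws
    using that by (induction ws) auto
  moreover have "replicate m c = concat (replicate m [c]) \<and> set (replicate m [c]) \<subseteq> {[c]}" for m
    by (induction m) auto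
  ultimately show ?thesis unfolding star_def by blast
qed

lemma star_single_replicate: "star {replicate k c} = range (\<lambda>m. replicate (k * m) c)"
proof -
  have "concat ws = replicate (k * length ws) c" if "set ws \<subseteq> {replicate k c}" for ws
    using that by (induction ws) (auto simp: replicate_add)
  moreover have "replicate (k * m) c = concat (replicate m (replicate k c))
      \<and> set (replicate m (replicate k c)) \<subseteq> {replicate k c}" for m
    by (induction m) (auto simp: replicate_add)
  ultimately show ?thesis unfolding star_def by blast
qed

lemma star_conc_base:
  assumes "y \<in> Y"
  shows "y \<in> conc (star X) Y"
proof -
  have "[] \<in> star X" unfolding star_def by (auto intro: exI[of _ "[]"])
  then show ?thesis unfolding conc_def using assms by auto
qed

text \<open>Peels off the leftmost factor; for walks this is the first sweep, the one that fixes the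
  lowest row.\<close>

lemma star_conc_induct [consumes 1, case_names base step]:
  assumes "w \<in> conc (star X) Y"
    and "\<And>w. w \<in> Y \<Longrightarrow> P w"
    and "\<And>u w. u \<in> X \<Longrightarrow> w \<in> conc (star X) Y \<Longrightarrow> P w \<Longrightarrow> P (u @ w)"
  shows "P w"
proof -
  from assms(1) obtain ws y where w: "w = concat ws @ y" "set ws \<subseteq> X" "y \<in> Y"
    unfolding conc_def star_def by blast
  from w(2) have "concat ws @ y \<in> conc (star X) Y \<and> P (concat ws @ y)"
  proof (induction ws)
    case Nil
    have "concat [] @ y \<in> conc (star X) Y" by (simp add: star_conc_base w(3))
    then show ?case using assms(2) w(3) by simp
  next
    case (Cons u ws)
    have "concat (u # ws) @ y \<in> conc (star X) Y"
      unfolding conc_def star_def using w(3) Cons.prems by blast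
    then show ?case using assms(3) Cons by simp
  qed
  then show ?thesis using w by simp
qed

lemma star_conc_step: "u \<in> X \<Longrightarrow> w \<in> conc (star X) Y \<Longrightarrow> u @ w \<in> conc (star X) Y"
proof -
  assume u: "u \<in> X" and "w \<in> conc (star X) Y"
  then obtain ws y where w: "w = concat ws @ y" "set ws \<subseteq> X" "y \<in> Y"
    unfolding conc_def star_def by blast
  have "u @ w = concat (u # ws) @ y" "set (u # ws) \<subseteq> X" using u w by auto
  then show ?thesis unfolding conc_def star_def using w(3) by blast
qed

section \<open>Semi-Thue derivations as walks on the lamp grid\<close>

definition rewr :: "('a list \<times> 'a list) set \<Rightarrow> 'a list \<Rightarrow> 'a list \<Rightarrow> bool" where
  "rewr R w w' \<longleftrightarrow> (\<exists>l u v r. (u, v) \<in> R \<and> w = l @ u @ r \<and> w' = l @ v @ r)"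

locale lamp_encoding =
  fixes k :: nat and e :: "'a \<Rightarrow> nat"
  assumes inj_e: "inj e" and e_less: "e c < k"
begin

definition put :: "'a \<Rightarrow> letter list" where
  "put c = replicate (e c) T1 @ [A] @ replicate (e c) T1inv"

definition unput :: "'a \<Rightarrow> letter list" where
  "unput c = [T2] @ replicate (e c) T1 @ [Ainv] @ replicate (e c) T1inv @ [T2inv]"

definition puts :: "'a list \<Rightarrow> letter list" where
  "puts a = concat (map (\<lambda>c. put c @ replicate k T1) a)"

definition unputs :: "'a list \<Rightarrow> letter list" where
  "unputs a = concat (map (\<lambda>c. unput c @ replicate k T1) a)"

text \<open>\<open>i\<close> and \<open>j\<close> are the lengths of the two sides of a rule. To the
  right of the replaced factor a letter reappears \<open>j - i\<close> blocks further right in the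
  row above. For a fixed rule this displacement is a constant, so there are only finitely many words
  \<open>copy i j c\<close>.\<close>

definition copy :: "nat \<Rightarrow> nat \<Rightarrow> 'a \<Rightarrow> letter list" where
  "copy i j c = put c @ replicate (k * j) T1 @ replicate (k * i) T1inv @ unput c
     @ replicate (k * i) T1 @ replicate (k * j) T1inv @ replicate k T1"

definition copies :: "nat \<Rightarrow> nat \<Rightarrow> 'a list \<Rightarrow> letter list" where
  "copies i j a = concat (map (copy i j) a)"

text \<open>The walk ends behind \<open>u\<close>, not behind \<open>v\<close>, because all later
  moves are measured in the coordinates of the lower row.\<close>

definition replace :: "'a list \<Rightarrow> 'a list \<Rightarrow> letter list" where
  "replace u v = puts u @ replicate (k * length u) T1inv @ unputs v
     @ replicate (k * length v) T1inv @ replicate (k * length u) T1"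

definition sweep :: "'a list \<Rightarrow> 'a list \<Rightarrow> 'a list \<Rightarrow> 'a list \<Rightarrow> letter list" where
  "sweep l u v r = copies 0 0 l @ replace u v @ copies (length u) (length v) r"

section \<open>Rows of lamps as encodings of words\<close>

fun row :: "'a list \<Rightarrow> int \<Rightarrow> int \<Rightarrow> int" where
  "row [] x y = 0"
| "row (c # a) x y = (if x = int (e c) \<and> y = 0 then 1 else 0) + row a (x - int k) y"

lemma row_append: "row (a @ b) x y = row a x y + row b (x - int (k * length a)) y"
  by (induction a arbitrary: x) (auto simp: algebra_simps)

lemma row_off: "y \<noteq> 0 \<Longrightarrow> row a x y = 0"
  by (induction a arbitrary: x) auto

lemma put_simps [simp]:
  "px (put c) = 0" "py (put c) = 0"
  "lamp (put c) x y = (if x = int (e c) \<and> y = 0 then 1 else 0)"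
  by (auto simp: put_def)

lemma unput_simps [simp]:
  "px (unput c) = 0" "py (unput c) = 0"
  "lamp (unput c) x y = (if x = int (e c) \<and> y = 1 then - 1 else 0)"
  by (auto simp: unput_def)

lemma puts_simps [simp]:
  "px (puts a) = int (k * length a)" "py (puts a) = 0" "lamp (puts a) x y = row a x y"
  by (induction a arbitrary: x) (auto simp: puts_def algebra_simps)

lemma unputs_simps [simp]:
  "px (unputs a) = int (k * length a)" "py (unputs a) = 0"
  "lamp (unputs a) x y = - row a x (y - 1)"
  by (induction a arbitrary: x) (auto simp: unputs_def algebra_simps)

lemma copies_simps [simp]:
  "px (copies i j a) = int (k * length a)" "py (copies i j a) = 0"
  "lamp (copies i j a) x y = row a x y - row a (x + int (k * i) - int (k * j)) (y - 1)"
proof -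
  show pos: "px (copies i j a) = int (k * length a)" "py (copies i j a) = 0" for a
    by (induction a) (auto simp: copies_def copy_def algebra_simps)
  show "lamp (copies i j a) x y = row a x y - row a (x + int (k * i) - int (k * j)) (y - 1)"
  proof (induction a arbitrary: x y)
    case Nil
    then show ?case by (simp add: copies_def)
  next
    case (Cons c a)
    have "copies i j (c # a) = copy i j c @ copies i j a" by (simp add: copies_def)
    moreover have "px (copy i j c) = int k" "py (copy i j c) = 0"
      "lamp (copy i j c) x y = (if x = int (e c) \<and> y = 0 then 1 else 0)
        - (if x + int (k * i) - int (k * j) = int (e c) \<and> y = 1 then 1 else 0)"
      by (auto simp: copy_def algebra_simps)
    moreover have "x - int k + int (k * i) - int (k * j) = x + int (k * i) - int (k * j) - int k"
      by simp
    ultimately show ?case by (simp only: lamp_append Cons) simp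
  qed
qed

lemma sweep_simps [simp]:
  "px (sweep l u v r) = int (k * length (l @ u @ r))" "py (sweep l u v r) = 0"
  "lamp (sweep l u v r) x y = row (l @ u @ r) x y - row (l @ v @ r) x (y - 1)"
  by (auto simp: sweep_def replace_def row_append algebra_simps)

text \<open>Offsets are smaller than \<open>k\<close>, so uniqueness of quotient and remainder shows
  that the lamps of different blocks never meet.\<close>

lemma row_eq:
  assumes "c < k"
  shows "row a (int k * i + int c) 0 =
    (if 0 \<le> i \<and> nat i < length a \<and> e (a ! nat i) = c then 1 else 0)"
proof (induction a arbitrary: i)
  case Nil
  then show ?case by simp
next
  case (Cons d a)
  have *: "int k * i + int c - int k = int k * (i - 1) + int c" by (simp add: algebra_simps)
  have **: "int k * i + int c = int (e d) \<longleftrightarrow> i = 0 \<and> c = e d"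
  proof
    assume h: "int k * i + int c = int (e d)"
    have "(int k * i + int c) div int k = i" using assms by (simp add: mult.commute)
    moreover have "int (e d) div int k = 0" using e_less[of d] by simp
    ultimately have "i = 0" using h by simp
    then show "i = 0 \<and> c = e d" using h by simp
  qed simp
  show ?case
  proof (cases "i \<le> 0")
    case True
    then show ?thesis unfolding row.simps * ** Cons by auto
  next
    case False
    then have "nat i = Suc (nat (i - 1))" by simp
    then show ?thesis using False unfolding row.simps * ** Cons by auto
  qed
qed

lemma row_01: "row a x y = 0 \<or> row a x y = 1"
proof (cases "y = 0")
  case True
  have "0 < k" using e_less by (metis gr_zeroI less_zeroE)
  then have "x = int k * (x div int k) + int (nat (x mod int k))" "nat (x mod int k) < k"
    by (auto simp: nat_less_iff)
  then show ?thesis using row_eq[of "nat (x mod int k)" a "x div int k"] True by metis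
qed (simp add: row_off)

text \<open>A word occupies consecutive blocks starting at its origin, so a nonempty row reveals its
  left end, its length and, as \<open>e\<close> is injective, its letters. The unknown shift
  \<open>d\<close> is allowed because a walk may return to the wrong column between two
  sweeps.\<close>

lemma row_inj:
  assumes "\<And>x. row a x 0 = row b (x - int k * d) 0"
  shows "a = b"
proof -
  have *: "0 \<le> i \<and> nat i < length a \<and> e (a ! nat i) = c \<longleftrightarrow>
      0 \<le> i - d \<and> nat (i - d) < length b \<and> e (b ! nat (i - d)) = c" if "c < k" for i c
  proof -
    have "row a (int k * i + int c) 0 = row b (int k * (i - d) + int c) 0"
      using assms[of "int k * i + int c"] by (simp add: algebra_simps)
    then show ?thesis unfolding row_eq[OF that] by (auto split: if_splits)
  qed
  have dom: "0 \<le> i \<and> nat i < length a \<longleftrightarrow> 0 \<le> i - d \<and> nat (i - d) < length b" for i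
    using * e_less by blast
  show ?thesis
  proof (cases "d = 0")
    case True
    have len: "i < length a \<longleftrightarrow> i < length b" for i using dom[of "int i"] True by simp
    have "length a = length b" using len by (metis linorder_less_linear less_irrefl)
    moreover have "a ! i = b ! i" if "i < length a" for i
      using *[OF e_less, of "int i" "a ! i"] that True injD[OF inj_e] by auto
    ultimately show ?thesis by (rule nth_equalityI)
  next
    case False
    have "a = []"
    proof (rule ccontr)
      assume "a \<noteq> []"
      then have "0 < length a" by simp
      with False show False
        \<comment> \<open>Block 0 is occupied by \<open>a\<close>, hence by \<open>b\<close>, which
          forces \<open>d < 0\<close>; but then \<open>b\<close> occupies block \<open>d\<close> and
          \<open>a\<close> does not.\<close>
        using dom[of 0] dom[of d] dom[of "d - 1"] dom[of "- 1"] by (cases "d < 0") auto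
    qed
    moreover from this have "b = []" using dom[of d] by auto
    ultimately show ?thesis by simp
  qed
qed

text \<open>A finite automaton cannot remember the length of the word, so the number
  \<open>m\<close> of blocks walked back is left free. A wrong choice only shifts the next row, and
  \<open>row_inj\<close> copes with shifts.\<close>

definition round :: "('a list \<times> 'a list) set \<Rightarrow> letter list set" where
  "round R = {sweep l u v r @ [T2] @ replicate (k * m) T1inv | l u v r m. (u, v) \<in> R}"

definition final :: "'a \<Rightarrow> letter list set" where
  "final acc = {puts (l @ [acc] @ r) | l r. True}"

definition paths :: "('a list \<times> 'a list) set \<Rightarrow> 'a \<Rightarrow> letter list set" where
  "paths R acc = conc (star (round R)) (final acc)"

text \<open>The trailing moves light no lamp. They let the endpoint agree with that of the target
  word; downward moves suffice vertically, since paths end at height at least 0.\<close>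

definition walks :: "('a list \<times> 'a list) set \<Rightarrow> 'a \<Rightarrow> letter list set" where
  "walks R acc = conc (paths R acc)
     (conc (star {[T1]}) (conc (star {[T1inv]}) (star {[T2inv]})))"

section \<open>Regularity of the set of walks\<close>

lemma finite_sym: "finite (UNIV :: 'a set)"
proof -
  have "range e \<subseteq> {..<k}" using e_less by auto
  then show ?thesis using inj_e finite_subset finite_imageD by blast
qed

lemma regular_copies: "regular (range (copies i j))"
proof -
  have "regular (range (copy i j))" by (intro regular_finite finite_imageI finite_sym)
  from regular_star[OF this] show ?thesis unfolding star_range copies_def .
qed

lemma regular_puts: "regular (range puts)"
proof -
  have "regular (range (\<lambda>c. put c @ replicate k T1))"
    by (intro regular_finite finite_imageI finite_sym)
  from regular_star[OF this] show ?thesis unfolding star_range puts_def .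
qed

text \<open>For a fixed rule, a round is a product of stars of finite sets and single words, and
  there are finitely many rules.\<close>

lemma regular_walks:
  assumes "finite R"
  shows "regular (walks R acc)"
proof -
  have "round R = (\<Union>(u, v)\<in>R. conc (range (copies 0 0)) (conc {replace u v}
      (conc (range (copies (length u) (length v))) (conc {[T2]} (star {replicate k T1inv})))))"
    unfolding round_def sweep_def star_single_replicate conc_def by fastforce
  also have "regular \<dots>"
    using assms by (intro regular_UN)
      (auto intro!: regular_conc regular_single regular_copies regular_star)
  finally have "regular (round R)" .
  moreover have "final acc = conc (range puts) (conc {puts [acc]} (range puts))"
    unfolding final_def conc_def puts_def by fastforce
  then have "regular (final acc)"
    by (simp add: regular_conc regular_puts regular_single)
  ultimately show ?thesis
    unfolding walks_def paths_def by (intro regular_conc regular_star regular_single)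
qed

section \<open>Equivalence of walks and derivations\<close>

lemma lamp_paths_below: "w \<in> paths R acc \<Longrightarrow> y < 0 \<Longrightarrow> lamp w x y = 0"
  unfolding paths_def
proof (induction arbitrary: x y rule: star_conc_induct)
  case (base w)
  then show ?case by (auto simp: final_def row_off)
next
  case (step u w)
  then show ?case by (auto simp: round_def row_off)
qed

lemma py_paths: "w \<in> paths R acc \<Longrightarrow> py w \<ge> 0"
  unfolding paths_def
proof (induction rule: star_conc_induct)
  case (base w)
  then show ?case by (auto simp: final_def)
next
  case (step u w)
  then show ?case by (auto simp: round_def)
qed

lemma row_mod_eq:
  assumes "n \<ge> 2" and "row a x y mod int n = row b x' y' mod int n"
  shows "row a x y = row b x' y'"
proof -
  have "row a x y mod int n = row a x y" "row b x' y' mod int n = row b x' y'"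
    using row_01[of a x y] row_01[of b x' y'] assms(1) by auto
  then show ?thesis using assms(2) by metis
qed

text \<open>The lowest row of the final configuration is only touched by the first sweep, and the next
  row must be cancelled by the rest of the walk, which therefore starts from the rewritten word.\<close>

lemma paths_sound:
  assumes "n \<ge> 2" and "w \<in> paths R acc"
    and "\<And>x y. lamp w x y mod int n = row b (x - int k * d) y mod int n"
  shows "\<exists>l r. (rewr R)\<^sup>*\<^sup>* b (l @ [acc] @ r)"
  using assms(2,3) unfolding paths_def
proof (induction arbitrary: b d rule: star_conc_induct)
  case (base w)
  then obtain l r where w: "w = puts (l @ [acc] @ r)" unfolding final_def by blast
  have "row (l @ [acc] @ r) x 0 = row b (x - int k * d) 0" for x
    using base(2)[of x 0] by (intro row_mod_eq[OF assms(1)]) (simp add: w)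
  then have "l @ [acc] @ r = b" by (rule row_inj)
  then show ?case by blast
next
  case (step s w)
  then obtain l u v r m where s: "s = sweep l u v r @ [T2] @ replicate (k * m) T1inv"
    and R: "(u, v) \<in> R" unfolding round_def by blast
  \<comment> \<open>The number of blocks by which the rest of the walk starts to the right of the
    origin of this sweep.\<close>
  define d' where "d' = int (length (l @ u @ r)) - int m"
  have lamp: "lamp (s @ w) x y = row (l @ u @ r) x y - row (l @ v @ r) x (y - 1)
      + lamp w (x - int k * d') (y - 1)" for x y
    by (simp add: s d'_def algebra_simps)
  have w: "w \<in> paths R acc" using step(2) by (simp add: paths_def)
  \<comment> \<open>At height 0 the subtracted row and the rest of the walk contribute
    nothing.\<close>
  have "row (l @ u @ r) x 0 = row b (x - int k * d) 0" for x
    using step(4)[of x 0] lamp_paths_below[OF w] unfolding lamp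
    by (intro row_mod_eq[OF assms(1)]) (simp add: row_off)
  then have b: "l @ u @ r = b" by (rule row_inj)
  have "lamp w x y mod int n = row (l @ v @ r) (x - int k * (- d')) y mod int n" for x y
  proof (cases "y < 0")
    case True
    then show ?thesis using lamp_paths_below[OF w] by (simp add: row_off)
  next
    case False
    \<comment> \<open>At height \<open>y + 1\<close>, which is at least 1, the target and the added
      row are dark, so \<open>w\<close> must make up for what this sweep subtracted.\<close>
    then have "(lamp w x y - row (l @ v @ r) (x + int k * d') y) mod int n = 0"
      using step(4)[of "x + int k * d'" "y + 1"] unfolding lamp by (simp add: row_off)
    then show ?thesis by (simp add: mod_eq_dvd_iff mod_0_imp_dvd)
  qed
  then obtain l' r' where "(rewr R)\<^sup>*\<^sup>* (l @ v @ r) (l' @ [acc] @ r')" using step(3) by blast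
  moreover have "rewr R b (l @ v @ r)" unfolding rewr_def using R b by blast
  ultimately show ?case by (meson converse_rtranclp_into_rtranclp)
qed

lemma paths_complete:
  assumes "(rewr R)\<^sup>*\<^sup>* b (l @ [acc] @ r)"
  shows "\<exists>w\<in>paths R acc. \<forall>x y. lamp w x y = row b x y"
  using assms
proof (induction rule: converse_rtranclp_induct)
  case base
  have "puts (l @ [acc] @ r) \<in> paths R acc"
    unfolding paths_def final_def by (intro star_conc_base) blast
  then show ?case by (metis puts_simps(3))
next
  case (step b b')
  then obtain w where w: "w \<in> paths R acc" "\<And>x y. lamp w x y = row b' x y" by blast
  from step(1) obtain l u v r where R: "(u, v) \<in> R" and b: "b = l @ u @ r" "b' = l @ v @ r"
    unfolding rewr_def by blast
  \<comment> \<open>Walking back by exactly \<open>length b\<close> blocks starts the next sweep in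
    the same column.\<close>
  define s where "s = sweep l u v r @ [T2] @ replicate (k * length b) T1inv"
  have "s \<in> round R" unfolding round_def s_def using R by blast
  then have "s @ w \<in> paths R acc" using w(1) unfolding paths_def by (rule star_conc_step)
  moreover have "lamp (s @ w) x y = row b x y" for x y
    by (simp add: s_def w(2) b)
  ultimately show ?case by blast
qed

theorem walks_correct:
  assumes "n \<ge> 2"
  shows "wr_eval n (puts b) \<in> wr_eval n ` walks R acc \<longleftrightarrow>
    (\<exists>l r. (rewr R)\<^sup>*\<^sup>* b (l @ [acc] @ r))"
proof
  assume "wr_eval n (puts b) \<in> wr_eval n ` walks R acc"
  then obtain w i j m where w: "w \<in> paths R acc" and eq: "wr_eval n (puts b) =
      wr_eval n (w @ replicate i T1 @ replicate j T1inv @ replicate m T2inv)"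
    unfolding walks_def conc_def star_single by blast
  from eq have "lamp w x y mod int n = row b (x - int k * 0) y mod int n" for x y
    by (simp add: wr_eval_eq_iff)
  then show "\<exists>l r. (rewr R)\<^sup>*\<^sup>* b (l @ [acc] @ r)" by (rule paths_sound[OF assms w])
next
  assume "\<exists>l r. (rewr R)\<^sup>*\<^sup>* b (l @ [acc] @ r)"
  then obtain w where w: "w \<in> paths R acc" "\<And>x y. lamp w x y = row b x y"
    using paths_complete by blast
  \<comment> \<open>As \<open>nat\<close> sends negative numbers to 0, at most one of the two
    horizontal corrections is nonempty.\<close>
  define z where "z = w @ replicate (nat (px (puts b) - px w)) T1
    @ replicate (nat (px w - px (puts b))) T1inv @ replicate (nat (py w)) T2inv"
  have "z \<in> walks R acc"
    unfolding z_def walks_def conc_def star_single using w(1) by blast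
  moreover have "wr_eval n (puts b) = wr_eval n z"
    using py_paths[OF w(1)] unfolding wr_eval_eq_iff by (auto simp: z_def w(2))
  ultimately show "wr_eval n (puts b) \<in> wr_eval n ` walks R acc" by blast
qed

end

section \<open>Compiling recursive functions to while programs\<close>

datatype com = Skip | Inc nat | Dec nat | Seq com com | While nat com

inductive exec :: "com \<Rightarrow> (nat \<Rightarrow> nat) \<Rightarrow> (nat \<Rightarrow> nat) \<Rightarrow> bool" where
  Skip: "exec Skip s s"
| Inc: "exec (Inc r) s (s(r := Suc (s r)))"
| Dec: "exec (Dec r) s (s(r := s r - 1))"
| Seq: "exec c s t \<Longrightarrow> exec d t u \<Longrightarrow> exec (Seq c d) s u"
| WhileF: "s r = 0 \<Longrightarrow> exec (While r c) s s"
| WhileT: "s r \<noteq> 0 \<Longrightarrow> exec c s t \<Longrightarrow> exec (While r c) t u \<Longrightarrow> exec (While r c) s u"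

definition clear :: "nat \<Rightarrow> com" where
  "clear r = While r (Dec r)"

definition transfer :: "nat \<Rightarrow> nat \<Rightarrow> com" where
  "transfer a b = While a (Seq (Dec a) (Inc b))"

definition dup :: "nat \<Rightarrow> nat \<Rightarrow> nat \<Rightarrow> com" where
  "dup a b t = Seq (transfer a t) (While t (Seq (Dec t) (Seq (Inc a) (Inc b))))"

text \<open>\<open>as\<close> lists the argument registers, \<open>b\<close> receives the result and
  the registers from \<open>k\<close> on are scratch space. In \<open>Prim\<close>, register
  \<open>k\<close> counts the remaining rounds, \<open>k + 1\<close> holds the recursion index and
  \<open>k + 2\<close> the next value. In \<open>Mn\<close>, \<open>b\<close> itself is the
  candidate and \<open>k\<close> holds the value of \<open>f\<close> there.\<close>

fun compile :: "recf \<Rightarrow> nat list \<Rightarrow> nat \<Rightarrow> nat \<Rightarrow> com"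
  and compiles :: "recf list \<Rightarrow> nat list \<Rightarrow> nat \<Rightarrow> nat \<Rightarrow> com" where
  "compile Zf as b k = Skip"
| "compile Sf as b k = Seq (dup (hd as) b k) (Inc b)"
| "compile (Proj i) as b k = dup (as ! i) b k"
| "compile (Comp f gs) as b k =
    Seq (compiles gs as k (k + length gs))
     (Seq (compile f [k..<k + length gs] b (k + length gs))
       (fold (\<lambda>r c. Seq c (clear r)) [k..<k + length gs] Skip))"
| "compile (Prim f g) as b k =
    Seq (dup (hd as) k (k + 1))
     (Seq (compile f (tl as) b (k + 3))
       (Seq (While k
          (Seq (compile g (b # (k + 1) # tl as) (k + 2) (k + 3))
            (Seq (clear b) (Seq (transfer (k + 2) b) (Seq (Inc (k + 1)) (Dec k))))))
         (clear (k + 1))))"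
| "compile (Mn f) as b k =
    Seq (compile f (b # as) k (k + 1))
      (While k (Seq (clear k) (Seq (Inc b) (compile f (b # as) k (k + 1)))))"
| "compiles [] as b k = Skip"
| "compiles (g # gs) as b k = Seq (compile g as b k) (compiles gs as (Suc b) k)"

section \<open>Correctness of the compilation\<close>

lemma exec_eq: "exec c s t \<Longrightarrow> t = u \<Longrightarrow> exec c s u"
  by simp

lemma exec_clear: "exec (clear r) s (s(r := 0))"
proof (induction "s r" arbitrary: s)
  case 0
  then show ?case unfolding clear_def by (intro exec_eq[OF WhileF]) auto
next
  case (Suc m)
  then have "exec (While r (Dec r)) (s(r := s r - 1)) (s(r := 0))"
    using Suc(1)[of "s(r := s r - 1)"] by (simp add: clear_def)
  then show ?case unfolding clear_def using Suc(2) by (auto intro: WhileT[OF _ Dec])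
qed

lemma exec_transfer:
  assumes "a \<noteq> b"
  shows "exec (transfer a b) s (s(a := 0, b := s b + s a))"
proof (induction "s a" arbitrary: s)
  case 0
  then show ?case unfolding transfer_def by (intro exec_eq[OF WhileF]) auto
next
  case (Suc m)
  define t where "t = s(a := s a - 1, b := Suc (s b))"
  have "exec (Seq (Dec a) (Inc b)) s t"
    by (rule Seq[OF Dec], rule exec_eq[OF Inc]) (use assms in \<open>auto simp: t_def\<close>)
  moreover have "exec (transfer a b) t (t(a := 0, b := t b + t a))"
    by (rule Suc(1)) (use Suc(2) assms in \<open>auto simp: t_def\<close>)
  moreover have "t(a := 0, b := t b + t a) = s(a := 0, b := s b + s a)"
    using Suc(2) assms by (auto simp: t_def)
  ultimately show ?case using WhileT[of s a _ t] Suc(2) unfolding transfer_def by simp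
qed

lemma exec_dup:
  assumes "a \<noteq> b" "t \<noteq> a" "t \<noteq> b" "s t = 0"
  shows "exec (dup a b t) s (s(b := s b + s a))"
proof -
  \<comment> \<open>The shadowed state \<open>s\<close> is arbitrary, as the induction changes it;
    the claim is applied after \<open>a\<close> has been emptied into \<open>t\<close>.\<close>
  have restore: "exec (While t (Seq (Dec t) (Seq (Inc a) (Inc b)))) s
      (s(t := 0, a := s a + s t, b := s b + s t))" for s
  proof (induction "s t" arbitrary: s)
    case 0
    then show ?case by (intro exec_eq[OF WhileF]) auto
  next
    case (Suc m)
    define u where "u = s(t := s t - 1, a := Suc (s a), b := Suc (s b))"
    have "exec (Seq (Dec t) (Seq (Inc a) (Inc b))) s u"
      by (rule Seq[OF Dec Seq[OF Inc]], rule exec_eq[OF Inc]) (use assms in \<open>auto simp: u_def\<close>)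
    moreover have "exec (While t (Seq (Dec t) (Seq (Inc a) (Inc b)))) u
        (u(t := 0, a := u a + u t, b := u b + u t))"
      by (rule Suc(1)) (use Suc(2) assms in \<open>auto simp: u_def\<close>)
    moreover have "u(t := 0, a := u a + u t, b := u b + u t)
        = s(t := 0, a := s a + s t, b := s b + s t)"
      using Suc(2) assms by (auto simp: u_def)
    ultimately show ?case using WhileT[of s t _ u] Suc(2) by simp
  qed
  show ?thesis unfolding dup_def
    by (rule Seq[OF exec_transfer exec_eq[OF restore]]) (use assms in auto)
qed

lemma exec_fold_clear:
  assumes "exec c s t"
  shows "exec (fold (\<lambda>r c. Seq c (clear r)) rs c) s (\<lambda>i. if i \<in> set rs then 0 else t i)"
  using assms
proof (induction rs arbitrary: c t)
  case Nil
  then show ?case by simp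
next
  case (Cons r rs)
  have "exec (Seq c (clear r)) s (t(r := 0))" by (rule Seq[OF Cons.prems exec_clear])
  from Cons.IH[OF this] show ?case by (auto elim!: exec_eq)
qed

text \<open>The calling convention: on entry the result register and all scratch registers are 0. By
  \<open>correct\<close>, only the result register differs on exit, so scratch space can be
  reused.\<close>

definition frame :: "nat list \<Rightarrow> nat list \<Rightarrow> nat \<Rightarrow> nat \<Rightarrow> (nat \<Rightarrow> nat) \<Rightarrow> bool" where
  "frame as xs b k s \<longleftrightarrow> map s as = xs \<and> (\<forall>a\<in>set as. a < k \<and> a \<noteq> b) \<and> b < k \<and> s b = 0
     \<and> (\<forall>i\<ge>k. s i = 0)"

definition correct :: "recf \<Rightarrow> bool" where
  "correct f \<longleftrightarrow> (\<forall>as xs b k s y. frame as xs b k s \<longrightarrow> reval f xs y \<longrightarrow>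
     exec (compile f as b k) s (s(b := y)))"

lemma correctD: "correct f \<Longrightarrow> reval f xs y \<Longrightarrow> frame as xs b k s \<Longrightarrow> t = s(b := y) \<Longrightarrow>
    exec (compile f as b k) s t"
  unfolding correct_def by blast

text \<open>Unfolds the recursion into the sequence of intermediate values, which the invariant of
  the compiled loop refers to.\<close>

lemma prim_values:
  assumes "reval (Prim f g) (m # xs) y"
  shows "\<exists>\<rho>. reval f xs (\<rho> 0) \<and> (\<forall>i<m. reval g (\<rho> i # i # xs) (\<rho> (Suc i))) \<and> \<rho> m = y"
  using assms
proof (induction m arbitrary: y)
  case 0
  then have "reval f xs y" by (cases rule: reval.cases) auto
  then show ?case by (intro exI[of _ "\<lambda>_. y"]) simp
next
  case (Suc m)
  from Suc(2) obtain r where r: "reval (Prim f g) (m # xs) r" "reval g (r # m # xs) y"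
    by (cases rule: reval.cases) auto
  from Suc(1)[OF r(1)] obtain \<rho> where \<rho>: "reval f xs (\<rho> 0)"
    "\<forall>i<m. reval g (\<rho> i # i # xs) (\<rho> (Suc i))" "\<rho> m = r" by blast
  show ?case
    by (rule exI[of _ "\<rho>(Suc m := y)"]) (use \<rho> r(2) in \<open>auto simp: less_Suc_eq\<close>)
qed

text \<open>The arguments lie below \<open>b\<close>, so results already stored from
  \<open>b\<close> on do not disturb them.\<close>

lemma exec_compiles:
  assumes "\<forall>g\<in>set gs. correct g" "list_all2 (\<lambda>g v. reval g xs v) gs vs"
    and "map s as = xs" "\<forall>a\<in>set as. a < b" "b + length gs \<le> k" "\<forall>i\<ge>b. s i = 0"
  shows "exec (compiles gs as b k) s
    (\<lambda>i. if b \<le> i \<and> i < b + length gs then vs ! (i - b) else s i)"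
  using assms
proof (induction gs arbitrary: vs b s)
  case Nil
  have "s = (\<lambda>i. if b \<le> i \<and> i < b + length [] then vs ! (i - b) else s i)" by auto
  then show ?case using exec.Skip by simp
next
  case (Cons g gs)
  from Cons.prems(2) obtain v vs' where vs: "vs = v # vs'" "reval g xs v"
    "list_all2 (\<lambda>g v. reval g xs v) gs vs'" by (cases vs) auto
  have 1: "exec (compile g as b k) s (s(b := v))"
    by (rule correctD[OF _ vs(2)]) (use Cons.prems in \<open>auto simp: frame_def\<close>)
  have "exec (compiles gs as (Suc b) k) (s(b := v))
     (\<lambda>i. if Suc b \<le> i \<and> i < Suc b + length gs then vs' ! (i - Suc b) else (s(b := v)) i)"
    by (rule Cons.IH[OF _ vs(3)]) (use Cons.prems in \<open>auto simp: less_Suc_eq\<close>)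
  moreover have "(\<lambda>i. if Suc b \<le> i \<and> i < Suc b + length gs then vs' ! (i - Suc b) else (s(b := v)) i)
      = (\<lambda>i. if b \<le> i \<and> i < b + length (g # gs) then vs ! (i - b) else s i)"
    by (auto simp: fun_eq_iff vs(1) nth_Cons split: nat.splits)
      (metis Suc_diff_le diff_Suc_Suc nat.inject)
  ultimately show ?case using 1 by (auto intro: Seq)
qed

lemma correct_Comp:
  assumes f: "correct f" and gs: "\<forall>g\<in>set gs. correct g"
  shows "correct (Comp f gs)"
  unfolding correct_def
proof (intro allI impI)
  fix as xs b k s y
  assume fr: "frame as xs b k s" and "reval (Comp f gs) xs y"
  from this(2) obtain vs where vs: "list_all2 (\<lambda>g v. reval g xs v) gs vs" "reval f vs y"
    by (cases rule: reval.cases) auto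
  let ?k = "k + length gs"
  define t where "t = (\<lambda>i. if k \<le> i \<and> i < ?k then vs ! (i - k) else s i)"
  have len: "length vs = length gs" using vs(1) by (auto dest: list_all2_lengthD)
  have 1: "exec (compiles gs as k ?k) s t"
    unfolding t_def by (rule exec_compiles[OF gs vs(1)]) (use fr in \<open>auto simp: frame_def\<close>)
  have "map t [k..<?k] = vs"
    by (rule nth_equalityI) (auto simp: t_def len)
  then have 2: "exec (compile f [k..<?k] b ?k) t (t(b := y))"
    by (intro correctD[OF f vs(2)]) (use fr in \<open>auto simp: frame_def t_def\<close>)
  have 3: "exec (fold (\<lambda>r c. Seq c (clear r)) [k..<?k] Skip) (t(b := y)) (s(b := y))"
    by (rule exec_eq[OF exec_fold_clear[OF exec.Skip]])
      (use fr in \<open>auto simp: frame_def t_def fun_eq_iff\<close>)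
  show "exec (compile (Comp f gs) as b k) s (s(b := y))"
    unfolding compile.simps by (rule Seq[OF 1 Seq[OF 2 3]])
qed

lemma correct_Prim:
  assumes f: "correct f" and g: "correct g"
  shows "correct (Prim f g)"
  unfolding correct_def
proof (intro allI impI)
  fix as xs b k s y
  assume fr: "frame as xs b k s" and ev: "reval (Prim f g) xs y"
  from ev obtain m xs' where xs: "xs = m # xs'" by (cases rule: reval.cases) auto
  from fr xs obtain a as' where as: "as = a # as'" "s a = m" "map s as' = xs'"
    unfolding frame_def by (cases as) auto
  from prim_values[OF ev[unfolded xs]] obtain \<rho> where \<rho>: "reval f xs' (\<rho> 0)"
    "\<forall>i<m. reval g (\<rho> i # i # xs') (\<rho> (Suc i))" "\<rho> m = y" by blast
  have ne: "a < k" "a \<noteq> b" "b < k" "\<forall>a\<in>set as'. a < k \<and> a \<noteq> b" and z: "s b = 0" "\<forall>i\<ge>k. s i = 0"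
    using fr as by (auto simp: frame_def)
  have map: "map t as' = xs'" if "\<And>i. i < k \<Longrightarrow> i \<noteq> b \<Longrightarrow> t i = s i" for t
    unfolding as(3)[symmetric] map_eq_conv using that ne(4) by blast
  \<comment> \<open>The loop invariant after \<open>i\<close> rounds.\<close>
  define st where "st i = s(b := \<rho> i, k := m - i, k + 1 := i)" for i
  let ?body = "Seq (compile g (b # (k + 1) # as') (k + 2) (k + 3))
            (Seq (clear b) (Seq (transfer (k + 2) b) (Seq (Inc (k + 1)) (Dec k))))"
  have 1: "exec (dup a k (k + 1)) s (s(k := m))"
    by (rule exec_eq[OF exec_dup]) (use ne z as in auto)
  have 2: "exec (compile f as' b (k + 3)) (s(k := m)) (st 0)"
    by (rule correctD[OF f \<rho>(1)])
      (use ne z map[of "s(k := m)"] in \<open>force simp: frame_def st_def\<close>,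
       use ne z in \<open>auto simp: st_def fun_eq_iff\<close>)
  have body: "exec ?body (st i) (st (Suc i))" if "i < m" for i
  proof -
    let ?t = "(st i)(k + 2 := \<rho> (Suc i))"
    have "exec (compile g (b # (k + 1) # as') (k + 2) (k + 3)) (st i) ?t"
    proof (rule correctD[OF g \<rho>(2)[rule_format, OF that]])
      have "st i b = \<rho> i" "st i (k + 1) = i" using ne by (auto simp: st_def)
      moreover have "map (st i) as' = xs'" by (rule map) (auto simp: st_def)
      ultimately show "frame (b # (k + 1) # as') (\<rho> i # i # xs') (k + 2) (k + 3) (st i)"
        using ne z by (auto simp: frame_def st_def)
    qed simp
    moreover have "exec (Seq (transfer (k + 2) b) (Seq (Inc (k + 1)) (Dec k)))
        (?t(b := 0)) (st (Suc i))"
      by (rule Seq[OF exec_transfer Seq[OF Inc exec_eq[OF Dec]]])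
        (use ne z in \<open>auto simp: st_def fun_eq_iff\<close>)
    ultimately show ?thesis by (rule Seq[OF _ Seq[OF exec_clear]])
  qed
  have 3: "exec (While k ?body) (st i) (st m)" if "i \<le> m" for i
    using that
  proof (induction rule: inc_induct)
    case base
    show ?case by (rule WhileF) (simp add: st_def)
  next
    case (step i)
    show ?case by (rule WhileT[OF _ body step.IH]) (use step in \<open>auto simp: st_def\<close>)
  qed
  have 4: "exec (clear (k + 1)) (st m) (s(b := y))"
    by (rule exec_eq[OF exec_clear]) (use ne z \<rho>(3) in \<open>auto simp: st_def fun_eq_iff\<close>)
  show "exec (compile (Prim f g) as b k) s (s(b := y))"
    unfolding compile.simps as(1) list.sel
    by (rule Seq[OF 1 Seq[OF 2 Seq[OF 3[of 0] 4]]]) simp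
qed

lemma correct_Mn:
  assumes f: "correct f"
  shows "correct (Mn f)"
  unfolding correct_def
proof (intro allI impI)
  fix as xs b k s y
  assume fr: "frame as xs b k s" and ev: "reval (Mn f) xs y"
  from ev have y: "reval f (y # xs) 0" "\<forall>z<y. \<exists>v. reval f (z # xs) v \<and> v > 0"
    by (cases rule: reval.cases, auto)+
  then obtain v where v: "\<And>z. z < y \<Longrightarrow> reval f (z # xs) (v z) \<and> v z > 0" by metis
  \<comment> \<open>The values tested by the search; the default 0 at \<open>y\<close> is the value
    that ends the loop and also leaves register \<open>k\<close> cleared.\<close>
  define V where "V z = (if z < y then v z else 0)" for z
  have V: "reval f (z # xs) (V z)" if "z \<le> y" for z
    using that v y(1) by (auto simp: V_def)
  have ne: "b < k" "\<forall>a\<in>set as. a < k \<and> a \<noteq> b" "map s as = xs" and z: "s b = 0" "\<forall>i\<ge>k. s i = 0"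
    using fr by (auto simp: frame_def)
  define st where "st i = s(b := i, k := V i)" for i
  have run: "exec (compile f (b # as) k (k + 1)) (s(b := i)) (st i)" if "i \<le> y" for i
  proof (rule correctD[OF f V[OF that]])
    have "map (s(b := i)) as = xs" using ne by (auto simp flip: ne(3))
    then show "frame (b # as) (i # xs) k (k + 1) (s(b := i))"
      using ne z by (auto simp: frame_def)
  qed (simp add: st_def)
  let ?body = "Seq (clear k) (Seq (Inc b) (compile f (b # as) k (k + 1)))"
  have body: "exec ?body (st i) (st (Suc i))" if "i < y" for i
  proof -
    have "exec (Inc b) ((st i)(k := 0)) (s(b := Suc i))"
      by (rule exec_eq[OF Inc]) (use ne z in \<open>auto simp: st_def fun_eq_iff\<close>)
    then show ?thesis using run[of "Suc i"] that by (intro Seq[OF exec_clear Seq[OF _ run]]) auto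
  qed
  have loop: "exec (While k ?body) (st i) (st y)" if "i \<le> y" for i
    using that
  proof (induction rule: inc_induct)
    case base
    show ?case by (rule WhileF) (simp add: st_def V_def)
  next
    case (step i)
    show ?case by (rule WhileT[OF _ body step.IH]) (use step v in \<open>auto simp: st_def V_def\<close>)
  qed
  have "s(b := 0) = s" "st y = s(b := y)" using ne z by (auto simp: st_def V_def fun_eq_iff)
  then show "exec (compile (Mn f) as b k) s (s(b := y))"
    unfolding compile.simps using Seq[OF run[of 0] loop[of 0]] by simp
qed

theorem correct_compile: "correct f"
proof (induction f)
  case Zf
  show ?case unfolding correct_def
  proof (intro allI impI)
    fix as xs b k s y
    assume fr: "frame as xs b k s" and "reval Zf xs y"
    from this(2) have "y = 0" by (cases rule: reval.cases) auto
    with fr have "s(b := y) = s" by (auto simp: frame_def)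
    then show "exec (compile Zf as b k) s (s(b := y))" using exec.Skip by simp
  qed
next
  case Sf
  show ?case unfolding correct_def
  proof (intro allI impI)
    fix as xs b k s y
    assume fr: "frame as xs b k s" and "reval Sf xs y"
    from this(2) obtain x xs' where "xs = x # xs'" "y = Suc x" by (cases rule: reval.cases) auto
    with fr show "exec (compile Sf as b k) s (s(b := y))"
      unfolding compile.simps
      by (cases as; intro Seq[OF exec_dup exec_eq[OF Inc]]) (auto simp: frame_def)
  qed
next
  case (Proj i)
  show ?case unfolding correct_def
  proof (intro allI impI)
    fix as xs b k s y
    assume fr: "frame as xs b k s" and "reval (Proj i) xs y"
    from this(2) have y: "i < length xs" "y = xs ! i" by (cases rule: reval.cases, auto)+
    with fr have i: "i < length as" "as ! i \<in> set as" "s (as ! i) = y" by (auto simp: frame_def)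
    with fr show "exec (compile (Proj i) as b k) s (s(b := y))"
      unfolding compile.simps by (intro exec_eq[OF exec_dup]) (auto simp: frame_def)
  qed
qed (simp_all add: correct_Comp correct_Prim correct_Mn)

section \<open>A universal semi-Thue system\<close>

text \<open>A configuration consists of \<open>Border\<close>, the registers in unary, each closed
  by \<open>Hash\<close> or, for the current register, by \<open>Ptr\<close>, and the program text,
  with exactly one head somewhere. Heads named with \<open>G\<close> run left to \<open>Ptr\<close>;
  \<open>DD\<close>, \<open>TZ\<close> and \<open>TH\<close> decrement or test there;
  \<open>KK\<close> and \<open>UU\<close> run back to an opening bracket.\<close>

datatype sym = Border | One | Hash | Ptr | Cur
  | Rt | Lf | Ic | Dc | Op | Cl | OpA | OpS | Hlt
  | F | GRt | GLf | GIc | GDc | GOp | GHlt | DD | MvR | MvL | TZ | TH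
  | Ret | RetS | SK | UU | KK | Acc

definition heads :: "sym set" where
  "heads = {F, GRt, GLf, GIc, GDc, GOp, GHlt, DD, MvR, MvL, TZ, TH, Ret, RetS, SK, UU, KK, Acc}"

text \<open>The right-hand sides of the rules whose left-hand side is \<open>[q, b]\<close> respectively \<open>[a, q]\<close>;
  the empty word stands for the absence of a rule.  The cursor \<open>F\<close> stands in front of the next
  instruction; executing an instruction leaves \<open>Cur\<close> behind it, walks left to the register
  pointer \<open>Ptr\<close> and returns to \<open>Cur\<close> as \<open>Ret\<close>, or as \<open>RetS\<close> to go on in skip mode \<open>SK\<close>.
  \<open>OpA\<close> marks the open brackets of the loops being executed and of a skipped loop, \<open>OpS\<close> those
  of the loops nested in a skipped one.\<close>

definition rr :: "sym \<Rightarrow> sym \<Rightarrow> sym list" where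
  "rr q b = (case q of
     F \<Rightarrow> (case b of Rt \<Rightarrow> [GRt, Rt, Cur] | Lf \<Rightarrow> [GLf, Lf, Cur] | Ic \<Rightarrow> [GIc, Ic, Cur]
       | Dc \<Rightarrow> [GDc, Dc, Cur] | Op \<Rightarrow> [GOp, OpA, Cur] | Cl \<Rightarrow> [KK, Cl] | Hlt \<Rightarrow> [GHlt, Hlt] | _ \<Rightarrow> [])
   | MvR \<Rightarrow> (case b of One \<Rightarrow> [One, MvR] | Hash \<Rightarrow> [Ptr, Ret] | _ \<Rightarrow> [])
   | Ret \<Rightarrow> (if b = Cur then [F] else if b \<in> heads then [] else [b, Ret])
   | RetS \<Rightarrow> (if b = Cur then [SK] else if b \<in> heads then [] else [b, RetS])
   | SK \<Rightarrow> (case b of Rt \<Rightarrow> [Rt, SK] | Lf \<Rightarrow> [Lf, SK] | Ic \<Rightarrow> [Ic, SK] | Dc \<Rightarrow> [Dc, SK]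
       | Op \<Rightarrow> [OpS, SK] | Cl \<Rightarrow> [UU, Cl, Cur] | _ \<Rightarrow> [])
   | _ \<Rightarrow> [])"

definition go :: "sym \<Rightarrow> sym \<Rightarrow> sym list \<Rightarrow> sym \<Rightarrow> sym list" where
  "go q t v a = (if a = t then v else if a \<in> heads then [] else [q, a])"

definition ll :: "sym \<Rightarrow> sym \<Rightarrow> sym list" where
  "ll a q = (case q of
     GRt \<Rightarrow> go GRt Ptr [Hash, MvR] a
   | GLf \<Rightarrow> go GLf Ptr [MvL, Hash] a
   | GIc \<Rightarrow> go GIc Ptr [One, Ptr, Ret] a
   | GDc \<Rightarrow> go GDc Ptr [DD, Ptr] a
   | GOp \<Rightarrow> go GOp Ptr [TZ, Ptr] a
   | GHlt \<Rightarrow> go GHlt Ptr [TH, Ptr] a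
   | DD \<Rightarrow> (if a = One then [Ret] else if a \<in> heads then [] else [a, Ret])
   | TZ \<Rightarrow> (if a = One then [One, Ret] else if a \<in> heads then [] else [a, RetS])
   | TH \<Rightarrow> (if a = One \<or> a \<in> heads then [] else [Acc])
   | MvL \<Rightarrow> (case a of One \<Rightarrow> [MvL, One] | Hash \<Rightarrow> [Ptr, Ret] | _ \<Rightarrow> [])
   | KK \<Rightarrow> go KK OpA [F, Op] a
   | UU \<Rightarrow> (if a = OpA then [Op, Ret] else go UU OpS [Op, RetS] a)
   | _ \<Rightarrow> [])"

definition rules :: "(sym list \<times> sym list) set" where
  "rules = {([q, b], rr q b) | q b. rr q b \<noteq> []} \<union> {([a, q], ll a q) | a q. ll a q \<noteq> []}"

lemma finite_UNIV_sym: "finite (UNIV :: sym set)"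
proof -
  have "UNIV = {Border, One, Hash, Ptr, Cur, Rt, Lf, Ic, Dc, Op, Cl, OpA, OpS, Hlt,
    F, GRt, GLf, GIc, GDc, GOp, GHlt, DD, MvR, MvL, TZ, TH, Ret, RetS, SK, UU, KK, Acc}"
    using sym.nchotomy by blast
  then show ?thesis by (metis finite.emptyI finite.insertI)
qed

lemma finite_rules: "finite rules"
proof -
  have "finite (range (\<lambda>(q, b). ([q, b], rr q b)) \<union> range (\<lambda>(a, q). ([a, q], ll a q)))"
    using finite_UNIV_sym by (simp add: finite_Prod_UNIV)
  then show ?thesis by (rule rev_finite_subset) (auto simp: rules_def)
qed

section \<open>Determinism of the rewriting system\<close>

abbreviation nheads :: "sym list \<Rightarrow> nat" where
  "nheads w \<equiv> length (filter (\<lambda>c. c \<in> heads) w)"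

text \<open>Together with \<open>ll_head\<close> this yields determinism: both sides of every rule
  contain exactly one head, and heads that read to the right are disjoint from heads that read to
  the left.\<close>

lemma rr_head: "rr q b \<noteq> [] \<Longrightarrow> q \<in> heads \<and> q \<in> {F, MvR, Ret, RetS, SK} \<and> b \<notin> heads \<and> nheads (rr q b) = 1"
  by (cases q; simp add: rr_def; cases b; simp add: heads_def)

lemma ll_head: "ll a q \<noteq> [] \<Longrightarrow> q \<in> heads \<and> q \<notin> {F, MvR, Ret, RetS, SK} \<and> a \<notin> heads \<and> nheads (ll a q) = 1"
  by (cases q; simp add: ll_def go_def; cases a; simp add: go_def heads_def)

lemma head_unique:
  assumes "l @ q # r = l' @ q' # r'" "q \<in> heads" "q' \<in> heads"
    "nheads (l @ q # r) = 1"
  shows "l = l' \<and> q = q' \<and> r = r'"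
proof -
  have "filter (\<lambda>c. c \<in> heads) l = []" "filter (\<lambda>c. c \<in> heads) r = []"
    using assms(2,4) by auto
  moreover have "nheads (l' @ q' # r') = 1" using assms by metis
  then have "filter (\<lambda>c. c \<in> heads) l' = []" using assms(3) by auto
  ultimately have "\<forall>x\<in>set l. x \<notin> heads" "\<forall>x\<in>set l'. x \<notin> heads" by (auto simp: filter_empty_conv)
  then show ?thesis using assms(1-3)
  proof (induction l arbitrary: l')
    case Nil
    then show ?case by (cases l') auto
  next
    case (Cons a l)
    then show ?case by (cases l') auto
  qed
qed

abbreviation step :: "sym list \<Rightarrow> sym list \<Rightarrow> bool" where
  "step \<equiv> rewr rules"

lemma step_cases:
  assumes "step w w'"
  obtains (right) l q b r where "w = l @ q # b # r" "w' = l @ rr q b @ r" "rr q b \<noteq> []"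
  | (left) l a q r where "w = (l @ [a]) @ q # r" "w' = l @ ll a q @ r" "ll a q \<noteq> []"
  using assms unfolding rewr_def rules_def by auto

lemma step_nheads: "step w w' \<Longrightarrow> nheads w' = nheads w"
proof (erule step_cases)
  fix l q b r
  assume "w = l @ q # b # r" "w' = l @ rr q b @ r" "rr q b \<noteq> []"
  then show ?thesis using rr_head[of q b] by simp
next
  fix l a q r
  assume "w = (l @ [a]) @ q # r" "w' = l @ ll a q @ r" "ll a q \<noteq> []"
  then show ?thesis using ll_head[of a q] by simp
qed

text \<open>The only head fixes the place of the rewriting and the side on which it reads, hence the
  rule.\<close>

lemma step_deterministic:
  assumes "nheads w = 1" "step w w1" "step w w2"
  shows "w1 = w2"
  using assms(2)
proof (cases rule: step_cases)
  case (right l q b r)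
  from assms(3) show ?thesis
  proof (cases rule: step_cases)
    case right': (right l' q' b' r')
    have "l = l' \<and> q = q' \<and> b # r = b' # r'"
      by (rule head_unique) (use right right' rr_head assms(1) in \<open>auto\<close>)
    then show ?thesis using right right' by simp
  next
    case left: (left l' a q' r')
    have "l = l' @ [a] \<and> q = q' \<and> b # r = r'"
      by (rule head_unique) (use right left rr_head ll_head assms(1) in \<open>auto\<close>)
    then show ?thesis using right left rr_head ll_head by blast
  qed
next
  case left: (left l a q r)
  from assms(3) show ?thesis
  proof (cases rule: step_cases)
    case (right l' q' b r')
    have "l @ [a] = l' \<and> q = q' \<and> r = b # r'"
      by (rule head_unique) (use right left rr_head ll_head assms(1) in \<open>auto\<close>)
    then show ?thesis using right left rr_head ll_head by blast
  next
    case left': (left l' a' q' r')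
    have "l @ [a] = l' @ [a'] \<and> q = q' \<and> r = r'"
      by (rule head_unique) (use left left' ll_head assms(1) in \<open>auto\<close>)
    then show ?thesis using left left' by simp
  qed
qed

abbreviation steps :: "sym list \<Rightarrow> sym list \<Rightarrow> bool" where
  "steps \<equiv> step\<^sup>*\<^sup>*"

text \<open>Deterministic runs form a single path, and both terminal words are its end.\<close>

lemma steps_terminal_unique:
  assumes "steps w t" "steps w t'" "nheads w = 1" "\<And>u. \<not> step t u" "\<And>u. \<not> step t' u"
  shows "t = t'"
  using assms(1-3)
proof (induction rule: converse_rtranclp_induct)
  case base
  then show ?case using assms(4) by (metis converse_rtranclpE)
next
  case (step w v)
  from step(4) show ?case
  proof (cases rule: converse_rtranclpE)
    case base
    then show ?thesis using step(1) assms(5) by blast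
  next
    case (step v')
    then have "v' = v" using \<open>step w v\<close> step_deterministic \<open>nheads w = 1\<close> by blast
    then show ?thesis using \<open>step w v\<close> step(2) step.IH step_nheads \<open>nheads w = 1\<close> by metis
  qed
qed

lemma step_rr: "rr q b = v \<Longrightarrow> v \<noteq> [] \<Longrightarrow> step (l @ q # b # r) (l @ v @ r)"
  unfolding rewr_def rules_def by (intro exI[of _ l] exI[of _ "[q, b]"] exI[of _ v] exI[of _ r]) auto

lemma step_ll: "ll a q = v \<Longrightarrow> v \<noteq> [] \<Longrightarrow> step (l @ a # q # r) (l @ v @ r)"
  unfolding rewr_def rules_def by (intro exI[of _ l] exI[of _ "[a, q]"] exI[of _ v] exI[of _ r]) auto

section \<open>Configurations and the execution of single instructions\<close>

lemma travel_right:
  "\<forall>b\<in>set m. rr q b = [b, q] \<Longrightarrow> steps (l @ q # m @ r) (l @ m @ q # r)"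
proof (induction m arbitrary: l)
  case (Cons b m)
  have "step (l @ q # b # (m @ r)) (l @ [b, q] @ (m @ r))" using Cons by (intro step_rr) auto
  moreover have "steps ((l @ [b]) @ q # m @ r) ((l @ [b]) @ m @ q # r)"
    using Cons.IH[of "l @ [b]"] Cons.prems by simp
  ultimately show ?case by (simp add: converse_rtranclp_into_rtranclp)
qed simp

lemma travel_left:
  "\<forall>a\<in>set m. ll a q = [q, a] \<Longrightarrow> steps (l @ m @ q # r) (l @ q # m @ r)"
proof (induction m arbitrary: r rule: rev_induct)
  case (snoc a m)
  have "step ((l @ m) @ a # q # r) ((l @ m) @ [q, a] @ r)" using snoc by (intro step_ll) auto
  moreover have "steps (l @ m @ q # (a # r)) (l @ q # m @ (a # r))"
    using snoc.IH[of "a # r"] snoc.prems by simp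
  ultimately show ?case by (simp add: converse_rtranclp_into_rtranclp)
qed simp

definition cell :: "(nat \<Rightarrow> nat) \<Rightarrow> nat \<Rightarrow> sym list" where
  "cell s i = replicate (s i) One @ [Hash]"

definition lcells :: "(nat \<Rightarrow> nat) \<Rightarrow> nat \<Rightarrow> sym list" where
  "lcells s p = Border # concat (map (cell s) [0..<p])"

definition rcells :: "(nat \<Rightarrow> nat) \<Rightarrow> nat \<Rightarrow> nat \<Rightarrow> sym list" where
  "rcells s p N = concat (map (cell s) [Suc p..<N])"

definition conf :: "nat \<Rightarrow> (nat \<Rightarrow> nat) \<Rightarrow> nat \<Rightarrow> sym list \<Rightarrow> sym list \<Rightarrow> sym list" where
  "conf N s p u v = lcells s p @ replicate (s p) One @ Ptr # rcells s p N @ u @ F # v"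

definition passed :: "sym set" where
  "passed = {Rt, Lf, Ic, Dc, Op, Cl, OpA, OpS}"

lemma set_lcells: "set (lcells s p) \<subseteq> {Border, One, Hash}"
  by (auto simp: lcells_def cell_def split: if_splits)

lemma set_rcells: "set (rcells s p N) \<subseteq> {One, Hash}"
  by (auto simp: rcells_def cell_def split: if_splits)

text \<open>A zero register is recognised by a symbol other than \<open>One\<close> to its left;
  \<open>Border\<close> provides this symbol for register 0.\<close>

lemma lcells_last: "\<exists>l a. lcells s p = l @ [a] \<and> a \<in> {Border, Hash}"
  by (cases p) (auto simp: lcells_def cell_def)

lemma lcells_upd [simp]: "p \<le> r \<Longrightarrow> lcells (s(r := x)) p = lcells s p"
  by (auto simp: lcells_def cell_def intro!: arg_cong[of _ _ concat])

lemma rcells_upd [simp]: "r \<le> p \<Longrightarrow> rcells (s(r := x)) p N = rcells s p N"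
  by (auto simp: rcells_def cell_def intro!: arg_cong[of _ _ concat])

lemma lcells_Suc: "lcells s (Suc p) = lcells s p @ replicate (s p) One @ [Hash]"
  by (simp add: lcells_def cell_def)

lemma rcells_Suc:
  "Suc p < N \<Longrightarrow> rcells s p N = replicate (s (Suc p)) One @ Hash # rcells s (Suc p) N"
  by (simp add: rcells_def cell_def upt_conv_Cons)

lemma return_left:
  assumes "q \<in> {GRt, GLf, GIc, GDc, GOp, GHlt}" "set u \<subseteq> passed"
  shows "steps (l @ Ptr # rcells s p N @ u @ q # r) (l @ Ptr # q # rcells s p N @ u @ r)"
proof -
  have "\<forall>a\<in>set (rcells s p N @ u). ll a q = [q, a]"
    using assms set_rcells[of s p N] by (auto simp: passed_def ll_def go_def heads_def subset_iff)
  from travel_left[OF this, of "l @ [Ptr]"] show ?thesis by simp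
qed

lemma return_right:
  assumes "(q, q') \<in> {(Ret, F), (RetS, SK)}" "set m \<subseteq> {Border, One, Hash, Ptr} \<union> passed"
  shows "steps (l @ q # m @ Cur # r) (l @ m @ q' # r)"
proof -
  have "\<forall>b\<in>set m. rr q b = [b, q]"
    using assms by (auto simp: passed_def rr_def heads_def subset_iff)
  from travel_right[OF this] have "steps (l @ q # m @ Cur # r) (l @ m @ q # Cur # r)" .
  moreover have "step ((l @ m) @ q # Cur # r) ((l @ m) @ [q'] @ r)"
    by (rule step_rr) (use assms in \<open>auto simp: rr_def\<close>)
  ultimately show ?thesis by (simp add: rtranclp.rtrancl_into_rtrancl)
qed

text \<open>The common first half of the instructions that work at the pointer. \<open>Cur\<close>
  keeps the place in the program to which \<open>return_F\<close> later brings the cursor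
  back.\<close>

lemma fetch:
  assumes "rr F b = [q, b', Cur]" "q \<in> {GRt, GLf, GIc, GDc, GOp, GHlt}" "set u \<subseteq> passed"
  shows "steps (conf N s p u (b # v))
    (lcells s p @ replicate (s p) One @ Ptr # q # rcells s p N @ u @ b' # Cur # v)"
proof -
  have "step (conf N s p u (b # v))
      (lcells s p @ replicate (s p) One @ Ptr # rcells s p N @ u @ q # b' # Cur # v)"
    using step_rr[OF assms(1), of "lcells s p @ replicate (s p) One @ Ptr # rcells s p N @ u" v]
    by (simp add: conf_def)
  also have "steps \<dots>
      (lcells s p @ replicate (s p) One @ Ptr # q # rcells s p N @ u @ b' # Cur # v)"
    using return_left[OF assms(2,3), of "lcells s p @ replicate (s p) One"] by simp
  finally show ?thesis .
qed

lemma step_rr': "rr q b = v \<Longrightarrow> v \<noteq> [] \<Longrightarrow> x = l @ q # b # r \<Longrightarrow> y = l @ v @ r \<Longrightarrow> step x y"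
  using step_rr by simp

lemma step_ll': "ll a q = v \<Longrightarrow> v \<noteq> [] \<Longrightarrow> x = l @ a # q # r \<Longrightarrow> y = l @ v @ r \<Longrightarrow> step x y"
  using step_ll by simp

lemma return_F:
  assumes "set m \<subseteq> {Border, One, Hash, Ptr} \<union> passed"
    "x = l @ Ret # m @ Cur # v" "conf N s p u v = l @ m @ F # v"
  shows "steps x (conf N s p u v)"
  using return_right[of Ret F m l v] assms by simp

lemma run_Ic:
  assumes "set u \<subseteq> passed"
  shows "steps (conf N s p u (Ic # v)) (conf N (s(p := Suc (s p))) p (u @ [Ic]) v)"
proof -
  let ?l = "lcells s p @ replicate (s p) One"
  have "steps (conf N s p u (Ic # v)) (?l @ Ptr # GIc # rcells s p N @ u @ Ic # Cur # v)"
    using fetch[of Ic GIc Ic u N s p v] assms by (simp add: rr_def)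
  also have "step \<dots> (?l @ One # Ptr # Ret # rcells s p N @ u @ Ic # Cur # v)"
    by (rule step_ll'[of Ptr GIc "[One, Ptr, Ret]" _ ?l]) (auto simp: ll_def go_def)
  also have "steps \<dots> (conf N (s(p := Suc (s p))) p (u @ [Ic]) v)"
    by (rule return_F[of "rcells s p N @ u @ [Ic]" _ "?l @ [One, Ptr]"])
      (use assms set_rcells[of s p N] in
        \<open>auto simp: conf_def passed_def replicate_app_Cons_same\<close>)
  finally show ?thesis .
qed

lemma run_Dc:
  assumes "set u \<subseteq> passed"
  shows "steps (conf N s p u (Dc # v)) (conf N (s(p := s p - 1)) p (u @ [Dc]) v)"
proof -
  let ?l = "lcells s p @ replicate (s p) One"
  let ?r = "Ptr # rcells s p N @ u @ Dc # Cur # v"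
  have "steps (conf N s p u (Dc # v)) (?l @ Ptr # GDc # rcells s p N @ u @ Dc # Cur # v)"
    using fetch[of Dc GDc Dc u N s p v] assms by (simp add: rr_def)
  also have "step \<dots> (?l @ DD # ?r)"
    by (rule step_ll'[of Ptr GDc "[DD, Ptr]" _ ?l]) (auto simp: ll_def go_def)
  \<comment> \<open>At 0 nothing is erased, in agreement with truncated subtraction.\<close>
  also have "step (?l @ DD # ?r) (lcells s p @ replicate (s p - 1) One @ Ret # ?r)"
  proof (cases "s p")
    case 0
    obtain l a where l: "lcells s p = l @ [a]" "a \<in> {Border, Hash}" using lcells_last by blast
    show ?thesis
      by (rule step_ll'[of a DD "[a, Ret]" _ l]) (use l 0 in \<open>auto simp: ll_def heads_def\<close>)
  next
    case (Suc m)
    show ?thesis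
      by (rule step_ll'[of One DD "[Ret]" _ "lcells s p @ replicate m One"])
        (use Suc in \<open>auto simp: ll_def replicate_append_same[symmetric]\<close>)
  qed
  also have "steps \<dots> (conf N (s(p := s p - 1)) p (u @ [Dc]) v)"
    by (rule return_F[of "Ptr # rcells s p N @ u @ [Dc]" _ "lcells s p @ replicate (s p - 1) One"])
      (use assms set_rcells[of s p N] in \<open>auto simp: conf_def passed_def\<close>)
  finally show ?thesis .
qed

lemma run_Rt:
  assumes "set u \<subseteq> passed" "Suc p < N"
  shows "steps (conf N s p u (Rt # v)) (conf N s (Suc p) (u @ [Rt]) v)"
proof -
  let ?l = "lcells s p @ replicate (s p) One"
  let ?r = "rcells s (Suc p) N @ u @ Rt # Cur # v"
  have "steps (conf N s p u (Rt # v)) (?l @ Ptr # GRt # rcells s p N @ u @ Rt # Cur # v)"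
    using fetch[of Rt GRt Rt u N s p v] assms by (simp add: rr_def)
  \<comment> \<open>The old \<open>Ptr\<close> becomes the \<open>Hash\<close> closing register
    \<open>p\<close>; \<open>MvR\<close> then turns the next \<open>Hash\<close> into
    \<open>Ptr\<close>.\<close>
  also have "step \<dots> (lcells s (Suc p) @ MvR # replicate (s (Suc p)) One @ Hash # ?r)"
    by (rule step_ll'[of Ptr GRt "[Hash, MvR]" _ ?l])
      (use assms(2) in \<open>auto simp: ll_def go_def lcells_Suc rcells_Suc\<close>)
  also have "steps \<dots> (lcells s (Suc p) @ replicate (s (Suc p)) One @ MvR # Hash # ?r)"
    by (rule travel_right) (auto simp: rr_def)
  also have "step \<dots> (lcells s (Suc p) @ replicate (s (Suc p)) One @ Ptr # Ret # ?r)"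
    by (rule step_rr'[of MvR Hash "[Ptr, Ret]" _ "lcells s (Suc p) @ replicate (s (Suc p)) One"])
      (auto simp: rr_def)
  also have "steps \<dots> (conf N s (Suc p) (u @ [Rt]) v)"
    by (rule return_F[of "rcells s (Suc p) N @ u @ [Rt]" _
          "lcells s (Suc p) @ replicate (s (Suc p)) One @ [Ptr]"])
      (use assms set_rcells[of s "Suc p" N] in \<open>auto simp: conf_def passed_def\<close>)
  finally show ?thesis .
qed

lemma run_Lf:
  assumes "set u \<subseteq> passed" "Suc p < N"
  shows "steps (conf N s (Suc p) u (Lf # v)) (conf N s p (u @ [Lf]) v)"
proof -
  let ?l = "lcells s p @ replicate (s p) One"
  let ?r = "rcells s p N @ u @ Lf # Cur # v"
  have "steps (conf N s (Suc p) u (Lf # v)) (lcells s (Suc p) @ replicate (s (Suc p)) One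
      @ Ptr # GLf # rcells s (Suc p) N @ u @ Lf # Cur # v)"
    using fetch[of Lf GLf Lf u N s "Suc p" v] assms by (simp add: rr_def)
  also have "step \<dots> (lcells s (Suc p) @ replicate (s (Suc p)) One
      @ MvL # Hash # rcells s (Suc p) N @ u @ Lf # Cur # v)"
    by (rule step_ll'[of Ptr GLf "[MvL, Hash]" _ "lcells s (Suc p) @ replicate (s (Suc p)) One"])
      (auto simp: ll_def go_def)
  also have "steps \<dots> (lcells s (Suc p) @ MvL # ?r)"
    using travel_left[of "replicate (s (Suc p)) One" MvL "lcells s (Suc p)"] assms(2)
    by (simp add: ll_def rcells_Suc)
  also have "step \<dots> (?l @ Ptr # Ret # ?r)"
    by (rule step_ll'[of Hash MvL "[Ptr, Ret]" _ ?l]) (auto simp: ll_def lcells_Suc)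
  also have "steps \<dots> (conf N s p (u @ [Lf]) v)"
    by (rule return_F[of "rcells s p N @ u @ [Lf]" _ "?l @ [Ptr]"])
      (use assms set_rcells[of s p N] in \<open>auto simp: conf_def passed_def\<close>)
  finally show ?thesis .
qed

lemma test_cell:
  assumes "set u \<subseteq> passed"
  shows "steps (conf N s p u (Op # v)) (lcells s p @ replicate (s p) One
    @ (if s p = 0 then RetS else Ret) # Ptr # rcells s p N @ u @ OpA # Cur # v)"
proof -
  let ?l = "lcells s p @ replicate (s p) One"
  let ?r = "Ptr # rcells s p N @ u @ OpA # Cur # v"
  have "steps (conf N s p u (Op # v)) (?l @ Ptr # GOp # rcells s p N @ u @ OpA # Cur # v)"
    using fetch[of Op GOp OpA u N s p v] assms by (simp add: rr_def)
  also have "step \<dots> (?l @ TZ # ?r)"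
    by (rule step_ll'[of Ptr GOp "[TZ, Ptr]" _ ?l]) (auto simp: ll_def go_def)
  also have "step \<dots> (?l @ (if s p = 0 then RetS else Ret) # ?r)"
  proof (cases "s p")
    case 0
    obtain l a where l: "lcells s p = l @ [a]" "a \<in> {Border, Hash}" using lcells_last by blast
    show ?thesis
      by (rule step_ll'[of a TZ "[a, RetS]" _ l]) (use l 0 in \<open>auto simp: ll_def heads_def\<close>)
  next
    case (Suc m)
    show ?thesis
      by (rule step_ll'[of One TZ "[One, Ret]" _ "lcells s p @ replicate m One"])
        (use Suc in \<open>auto simp: ll_def replicate_append_same[symmetric]\<close>)
  qed
  finally show ?thesis by simp
qed

lemma run_Op:
  assumes "set u \<subseteq> passed" "s p \<noteq> 0"
  shows "steps (conf N s p u (Op # v)) (conf N s p (u @ [OpA]) v)"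
proof -
  note test_cell[OF assms(1), of N s p v]
  also have "steps (lcells s p @ replicate (s p) One
      @ (if s p = 0 then RetS else Ret) # Ptr # rcells s p N @ u @ OpA # Cur # v)
      (conf N s p (u @ [OpA]) v)"
    by (rule return_F[of "Ptr # rcells s p N @ u @ [OpA]" _ "lcells s p @ replicate (s p) One"])
      (use assms set_rcells[of s p N] in \<open>auto simp: conf_def passed_def\<close>)
  finally show ?thesis .
qed

text \<open>Finished inner loops carry \<open>Op\<close> again, so the nearest \<open>OpA\<close> is
  the partner of this \<open>Cl\<close>. The cursor is put in front of it, where the loop test is
  repeated.\<close>

lemma run_Cl:
  assumes "set m \<subseteq> passed - {OpA, OpS}"
  shows "steps (conf N s p (u @ OpA # m) (Cl # v)) (conf N s p u (Op # m @ Cl # v))"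
proof -
  let ?l = "lcells s p @ replicate (s p) One @ Ptr # rcells s p N @ u"
  have "step (conf N s p (u @ OpA # m) (Cl # v)) ((?l @ [OpA]) @ m @ KK # Cl # v)"
    by (rule step_rr'[of F Cl "[KK, Cl]" _ "?l @ [OpA] @ m"]) (auto simp: rr_def conf_def)
  also have "steps \<dots> ((?l @ [OpA]) @ KK # m @ Cl # v)"
    by (rule travel_left)
      (use assms in \<open>auto simp: passed_def ll_def go_def heads_def subset_iff\<close>)
  also have "step \<dots> (conf N s p u (Op # m @ Cl # v))"
    by (rule step_ll'[of OpA KK "[F, Op]" _ ?l]) (auto simp: ll_def go_def conf_def)
  finally show ?thesis .
qed

section \<open>While programs as words\<close>

text \<open>\<open>core c\<close> starts and ends with the pointer at \<open>addr c\<close>, and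
  \<open>code c\<close> with the pointer at register 0. A loop needs its own register at both
  brackets, hence its body is wrapped in \<open>leave\<close>.\<close>

fun addr :: "com \<Rightarrow> nat" where
  "addr (Inc r) = r" | "addr (Dec r) = r" | "addr (While r c) = r" | "addr _ = 0"

definition visit :: "nat \<Rightarrow> sym list \<Rightarrow> sym list" where
  "visit r m = replicate r Rt @ m @ replicate r Lf"

definition leave :: "nat \<Rightarrow> sym list \<Rightarrow> sym list" where
  "leave r m = replicate r Lf @ m @ replicate r Rt"

fun core :: "com \<Rightarrow> sym list" where
  "core Skip = []"
| "core (Inc r) = [Ic]"
| "core (Dec r) = [Dc]"
| "core (Seq c d) = visit (addr c) (core c) @ visit (addr d) (core d)"
| "core (While r c) = Op # leave r (visit (addr c) (core c)) @ [Cl]"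

definition code :: "com \<Rightarrow> sym list" where
  "code c = visit (addr c) (core c)"

fun bound :: "com \<Rightarrow> nat" where
  "bound Skip = 1" | "bound (Inc r) = Suc r" | "bound (Dec r) = Suc r"
| "bound (Seq c d) = max (bound c) (bound d)" | "bound (While r c) = max (Suc r) (bound c)"

lemma addr_bound: "addr c < bound c"
  by (induction c) auto

lemma set_core: "set (core c) \<subseteq> passed - {OpA, OpS}"
  by (induction c) (auto simp: passed_def visit_def leave_def)

lemma set_visit: "set m \<subseteq> passed - {OpA, OpS} \<Longrightarrow> set (visit r m) \<subseteq> passed - {OpA, OpS}"
  and set_leave: "set m \<subseteq> passed - {OpA, OpS} \<Longrightarrow> set (leave r m) \<subseteq> passed - {OpA, OpS}"
  by (auto simp: visit_def leave_def passed_def)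

section \<open>Skipping the body of a loop\<close>

lemma skip_simple:
  "set m \<subseteq> {Rt, Lf, Ic, Dc} \<Longrightarrow> steps (l @ SK # m @ r) (l @ m @ SK # r)"
  by (rule travel_right) (auto simp: rr_def subset_iff)

definition skippable :: "sym list \<Rightarrow> bool" where
  "skippable m \<longleftrightarrow> (\<forall>l r. steps (l @ SK # m @ r) (l @ m @ SK # r))"

lemma skippable_append: "skippable m \<Longrightarrow> skippable m' \<Longrightarrow> skippable (m @ m')"
proof (unfold skippable_def, intro allI)
  fix l r
  assume a: "\<forall>l r. steps (l @ SK # m @ r) (l @ m @ SK # r)"
    "\<forall>l r. steps (l @ SK # m' @ r) (l @ m' @ SK # r)"
  have "steps (l @ SK # m @ m' @ r) ((l @ m) @ SK # m' @ r)" using a(1) by simp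
  also have "steps \<dots> ((l @ m) @ m' @ SK # r)" using a(2) by blast
  finally show "steps (l @ SK # (m @ m') @ r) (l @ (m @ m') @ SK # r)" by simp
qed

lemma skippable_simple: "set m \<subseteq> {Rt, Lf, Ic, Dc} \<Longrightarrow> skippable m"
  unfolding skippable_def using skip_simple by blast

lemma skippable_replicate: "skippable (replicate r Rt)" "skippable (replicate r Lf)"
  by (rule skippable_simple; auto)+

lemma skippable_visit: "skippable m \<Longrightarrow> skippable (visit r m)"
  and skippable_leave: "skippable m \<Longrightarrow> skippable (leave r m)"
  unfolding visit_def leave_def by (auto intro!: skippable_append skippable_replicate)

text \<open>A closing bracket met in skip mode belongs to the nearest marked opening bracket: the mark
  \<open>OpA\<close> shows that it closes the skipped loop itself, the mark \<open>OpS\<close> that it closes an inner one.\<close>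

lemma skip_close:
  assumes "set m \<subseteq> passed - {OpA, OpS}" "(t, q) \<in> {(OpA, F), (OpS, SK)}"
  shows "steps (l @ t # m @ SK # Cl # r) (l @ Op # m @ Cl # q # r)"
proof -
  define q' where "q' = (if q = F then Ret else RetS)"
  have "step (l @ t # m @ SK # Cl # r) ((l @ [t]) @ m @ UU # Cl # Cur # r)"
    by (rule step_rr'[of SK Cl "[UU, Cl, Cur]" _ "l @ [t] @ m"]) (auto simp: rr_def)
  also have "steps \<dots> ((l @ [t]) @ UU # m @ Cl # Cur # r)"
    by (rule travel_left)
      (use assms(1) in \<open>auto simp: passed_def ll_def go_def heads_def subset_iff\<close>)
  also have "step \<dots> (l @ [Op] @ q' # (m @ [Cl]) @ Cur # r)"
    by (rule step_ll'[of t UU "[Op, q']" _ l]) (use assms(2) in \<open>auto simp: q'_def ll_def go_def\<close>)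
  also have "steps \<dots> (l @ [Op] @ (m @ [Cl]) @ q # r)"
  proof -
    have "set (m @ [Cl]) \<subseteq> {Border, One, Hash, Ptr} \<union> passed"
      using assms(1) by (auto simp: passed_def)
    moreover have "(q', q) \<in> {(Ret, F), (RetS, SK)}" using assms(2) by (auto simp: q'_def)
    ultimately show ?thesis using return_right[of q' q "m @ [Cl]" "l @ [Op]" r] by simp
  qed
  finally show ?thesis by simp
qed

text \<open>An inner loop is marked \<open>OpS\<close> on entry and unmarked at its closing bracket,
  so skipping restores the text and continues behind it.\<close>

lemma skippable_core: "skippable (core c)"
proof (induction c)
  case (While r c)
  let ?m = "leave r (visit (addr c) (core c))"
  have m: "skippable ?m" by (intro skippable_leave skippable_visit While)
  show ?case
    unfolding skippable_def
  proof (intro allI)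
    fix l v
    have "step (l @ SK # Op # ?m @ Cl # v) ((l @ [OpS]) @ SK # ?m @ Cl # v)"
      by (rule step_rr'[of SK Op "[OpS, SK]" _ l]) (auto simp: rr_def)
    also have "steps \<dots> ((l @ [OpS]) @ ?m @ SK # Cl # v)"
      using m unfolding skippable_def by blast
    also have "steps \<dots> (l @ Op # ?m @ Cl # SK # v)"
      using skip_close[OF set_leave[OF set_visit[OF set_core]], of OpS SK l] by simp
    finally show "steps (l @ SK # core (While r c) @ v) (l @ core (While r c) @ SK # v)" by simp
  qed
qed (auto intro: skippable_simple skippable_append skippable_visit)

lemma run_Op_zero:
  assumes "set u \<subseteq> passed" "s p = 0" "skippable m" "set m \<subseteq> passed - {OpA, OpS}"
  shows "steps (conf N s p u (Op # m @ Cl # v)) (conf N s p (u @ Op # m @ [Cl]) v)"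
proof -
  let ?l = "lcells s p @ replicate (s p) One"
  let ?m = "Ptr # rcells s p N @ u @ [OpA]"
  note test_cell[OF assms(1), of N s p "m @ Cl # v"]
  also have "steps (lcells s p @ replicate (s p) One @ (if s p = 0 then RetS else Ret)
      # Ptr # rcells s p N @ u @ OpA # Cur # m @ Cl # v) ((?l @ ?m) @ SK # m @ Cl # v)"
    using return_right[of RetS SK ?m ?l "m @ Cl # v"] assms(1,2) set_rcells[of s p N]
    by (auto simp: passed_def subset_iff)
  also have "steps \<dots> ((?l @ ?m) @ m @ SK # Cl # v)"
    using assms(3) unfolding skippable_def by blast
  also have "steps \<dots> (conf N s p (u @ Op # m @ [Cl]) v)"
    using skip_close[OF assms(4), of OpA F "?l @ Ptr # rcells s p N @ u" v]
    by (simp add: conf_def)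
  finally show ?thesis .
qed

section \<open>Execution of whole programs\<close>

lemma run_Rts:
  assumes "set u \<subseteq> passed" "p + r < N"
  shows "steps (conf N s p u (replicate r Rt @ v)) (conf N s (p + r) (u @ replicate r Rt) v)"
  using assms
proof (induction r arbitrary: u p)
  case (Suc r)
  have "steps (conf N s p u (Rt # replicate r Rt @ v)) (conf N s (Suc p) (u @ [Rt]) (replicate r Rt @ v))"
    using Suc by (intro run_Rt) auto
  also have "steps \<dots> (conf N s (Suc p + r) ((u @ [Rt]) @ replicate r Rt) v)"
    by (rule Suc.IH) (use Suc.prems in \<open>auto simp: passed_def\<close>)
  finally show ?case by simp
qed simp

lemma run_Lfs:
  assumes "set u \<subseteq> passed" "p + r < N"
  shows "steps (conf N s (p + r) u (replicate r Lf @ v)) (conf N s p (u @ replicate r Lf) v)"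
  using assms
proof (induction r arbitrary: u)
  case (Suc r)
  have "steps (conf N s (Suc (p + r)) u (Lf # replicate r Lf @ v))
      (conf N s (p + r) (u @ [Lf]) (replicate r Lf @ v))"
    using Suc by (intro run_Lf) auto
  also have "steps \<dots> (conf N s p ((u @ [Lf]) @ replicate r Lf) v)"
    by (rule Suc.IH) (use Suc.prems in \<open>auto simp: passed_def\<close>)
  finally show ?case by simp
qed simp

lemma set_moves: "set (replicate r Rt) \<subseteq> passed" "set (replicate r Lf) \<subseteq> passed"
  by (auto simp: passed_def)

lemma run_visit:
  assumes "\<And>u v. set u \<subseteq> passed \<Longrightarrow> steps (conf N s r u (m @ v)) (conf N t r (u @ m) v)"
    "set u \<subseteq> passed" "set m \<subseteq> passed" "r < N"
  shows "steps (conf N s 0 u (visit r m @ v)) (conf N t 0 (u @ visit r m) v)"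
proof -
  have "steps (conf N s 0 u (replicate r Rt @ m @ replicate r Lf @ v))
      (conf N s r (u @ replicate r Rt) (m @ replicate r Lf @ v))"
    using run_Rts[of u 0 r N s] assms by simp
  also have "steps \<dots> (conf N t r ((u @ replicate r Rt) @ m) (replicate r Lf @ v))"
    by (rule assms(1)) (use assms in \<open>auto simp: passed_def\<close>)
  also have "steps \<dots> (conf N t 0 (((u @ replicate r Rt) @ m) @ replicate r Lf) v)"
    using run_Lfs[of "(u @ replicate r Rt) @ m" 0 r N t v] assms set_moves[of r] by simp
  finally show ?thesis by (simp add: visit_def)
qed

lemma run_leave:
  assumes "\<And>u v. set u \<subseteq> passed \<Longrightarrow> steps (conf N s 0 u (m @ v)) (conf N t 0 (u @ m) v)"
    "set u \<subseteq> passed" "set m \<subseteq> passed" "r < N"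
  shows "steps (conf N s r u (leave r m @ v)) (conf N t r (u @ leave r m) v)"
proof -
  have "steps (conf N s r u (replicate r Lf @ m @ replicate r Rt @ v))
      (conf N s 0 (u @ replicate r Lf) (m @ replicate r Rt @ v))"
    using run_Lfs[of u 0 r N s] assms by simp
  also have "steps \<dots> (conf N t 0 ((u @ replicate r Lf) @ m) (replicate r Rt @ v))"
    by (rule assms(1)) (use assms in \<open>auto simp: passed_def\<close>)
  also have "steps \<dots> (conf N t r (((u @ replicate r Lf) @ m) @ replicate r Rt) v)"
    using run_Rts[of "(u @ replicate r Lf) @ m" 0 r N t v] assms set_moves[of r] by simp
  finally show ?thesis by (simp add: leave_def)
qed

text \<open>Induction on the execution with the surrounding text \<open>u\<close> and
  \<open>v\<close> arbitrary.\<close>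

lemma run_core:
  assumes "exec c s t" "bound c \<le> N" "set u \<subseteq> passed"
  shows "steps (conf N s (addr c) u (core c @ v)) (conf N t (addr c) (u @ core c) v)"
  using assms
proof (induction arbitrary: u v rule: exec.induct)
  case (Skip s)
  then show ?case by simp
next
  case (Inc r s)
  then show ?case using run_Ic[of u N s r v] by (simp add: fun_upd_def)
next
  case (Dec r s)
  then show ?case using run_Dc[of u N s r v] by (simp add: fun_upd_def)
next
  case (Seq c s t d w)
  have c: "set (core c) \<subseteq> passed" "set (core d) \<subseteq> passed" for c d using set_core by blast+
  have "steps (conf N s 0 u (visit (addr c) (core c) @ visit (addr d) (core d) @ v))
      (conf N t 0 (u @ visit (addr c) (core c)) (visit (addr d) (core d) @ v))"
    by (rule run_visit) (use Seq c addr_bound[of c] in auto)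
  also have "steps \<dots> (conf N w 0 ((u @ visit (addr c) (core c)) @ visit (addr d) (core d)) v)"
    by (rule run_visit)
      (use Seq c addr_bound[of d] set_visit[OF set_core, of "addr c" c] in auto)
  finally show ?case by simp
next
  case (WhileF s r c)
  let ?m = "leave r (visit (addr c) (core c))"
  have "steps (conf N s r u (Op # ?m @ Cl # v)) (conf N s r (u @ Op # ?m @ [Cl]) v)"
    by (rule run_Op_zero)
      (use WhileF set_leave[OF set_visit[OF set_core]]
        skippable_leave[OF skippable_visit[OF skippable_core]] in auto)
  then show ?case by simp
next
  case (WhileT s r c t w)
  let ?m = "leave r (visit (addr c) (core c))"
  have m: "set ?m \<subseteq> passed - {OpA, OpS}" by (intro set_leave set_visit set_core)
  have "steps (conf N s r u (Op # ?m @ Cl # v)) (conf N s r (u @ [OpA]) (?m @ Cl # v))"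
    by (rule run_Op) (use WhileT in auto)
  also have "steps \<dots> (conf N t r ((u @ [OpA]) @ ?m) (Cl # v))"
  proof (rule run_leave)
    show "steps (conf N s 0 u (visit (addr c) (core c) @ v))
        (conf N t 0 (u @ visit (addr c) (core c)) v)" if "set u \<subseteq> passed" for u v
      by (rule run_visit) (use WhileT that set_core[of c] addr_bound[of c] in auto)
    show "set (visit (addr c) (core c)) \<subseteq> passed" using set_visit[OF set_core] by blast
  qed (use WhileT.prems in \<open>auto simp: passed_def\<close>)
  \<comment> \<open>The mark is removed, so this is literally the start of the remaining loop, and
    the second induction hypothesis applies.\<close>
  also have "steps \<dots> (conf N t r u (Op # ?m @ Cl # v))"
    using run_Cl[OF m, of N t r u v] by simp
  also have "steps \<dots> (conf N w r (u @ core (While r c)) v)"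
    using WhileT.IH(2)[of u v] WhileT.prems by simp
  finally show ?case by simp
qed

lemma run_code:
  assumes "exec c s t" "bound c \<le> N" "set u \<subseteq> passed"
  shows "steps (conf N s 0 u (code c @ v)) (conf N t 0 (u @ code c) v)"
  unfolding code_def
  by (rule run_visit) (use assms run_core addr_bound[of c] set_core[of c] in auto)

section \<open>Acceptance by the rewriting system\<close>

lemma Acc_terminal:
  assumes "Acc \<in> set w" "nheads w = 1"
  shows "\<not> step w w'"
proof
  assume "step w w'"
  moreover from assms(1) obtain l r where w: "w = l @ Acc # r" by (meson split_list)
  have "Acc \<in> heads" by (simp add: heads_def)
  ultimately show False
  proof (cases rule: step_cases)
    case (right l' q b r')
    have "l = l' \<and> Acc = q \<and> r = b # r'"
      by (rule head_unique) (use right w assms(2) rr_head \<open>Acc \<in> heads\<close> in auto)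
    then show False using right by (auto simp: rr_def)
  next
    case (left l' a q r')
    have "l = l' @ [a] \<and> Acc = q \<and> r = r'"
      by (rule head_unique) (use left w assms(2) ll_head \<open>Acc \<in> heads\<close> in auto)
    then show False using left by (auto simp: ll_def)
  qed
qed

lemma TH_terminal:
  assumes "nheads (l @ One # TH # r) = 1"
  shows "\<not> step (l @ One # TH # r) w'"
proof
  assume "step (l @ One # TH # r) w'"
  moreover have "TH \<in> heads" by (simp add: heads_def)
  ultimately show False
  proof (cases rule: step_cases)
    case (right l' q b r')
    have "l @ [One] = l' \<and> TH = q \<and> r = b # r'"
      by (rule head_unique) (use right assms rr_head \<open>TH \<in> heads\<close> in auto)
    then show False using right by (auto simp: rr_def)
  next
    case (left l' a q r')
    have "l @ [One] = l' @ [a] \<and> TH = q \<and> r = r'"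
      by (rule head_unique) (use left assms ll_head \<open>TH \<in> heads\<close> in auto)
    then show False using left by (auto simp: ll_def)
  qed
qed

lemma steps_nheads: "steps w w' \<Longrightarrow> nheads w' = nheads w"
  by (induction rule: rtranclp_induct) (auto dest: step_nheads)

lemma nheads_conf: "set u \<subseteq> passed \<Longrightarrow> set v \<subseteq> passed \<union> {Hlt} \<Longrightarrow> nheads (conf N s p u v) = 1"
proof -
  assume "set u \<subseteq> passed" "set v \<subseteq> passed \<union> {Hlt}"
  then have "\<forall>c\<in>set (lcells s p @ replicate (s p) One @ Ptr # rcells s p N @ u @ v). c \<notin> heads"
    using set_lcells[of s p] set_rcells[of s p N]
    by (auto simp: passed_def heads_def subset_iff)
  then have "filter (\<lambda>c. c \<in> heads) (lcells s p @ replicate (s p) One @ Ptr # rcells s p N @ u @ v) = []"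
    by (simp add: filter_empty_conv)
  then show ?thesis by (simp add: conf_def heads_def)
qed

text \<open>The run reaches \<open>TH\<close> behind register \<open>r\<close>. At 0 one more step
  produces \<open>Acc\<close>. Otherwise \<open>TH\<close> is stuck behind a \<open>One\<close>, and
  since terminal words are unique, no word with \<open>Acc\<close> is reachable.\<close>

theorem machine_accepts_iff:
  assumes "exec c s t" "bound c \<le> N" "r < N"
  defines "w \<equiv> conf N s 0 [] (code c @ replicate r Rt @ [Hlt])"
  shows "(\<exists>l r. steps w (l @ [Acc] @ r)) \<longleftrightarrow> t r = 0"
proof -
  let ?u = "code c @ replicate r Rt"
  let ?l = "lcells t r @ replicate (t r) One"
  let ?r = "Ptr # rcells t r N @ ?u @ [Hlt]"
  have tc: "set (code c) \<subseteq> passed" using set_visit[OF set_core] by (auto simp: code_def)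
  then have u: "set ?u \<subseteq> passed" by (auto simp: passed_def)
  have n: "nheads w = 1" unfolding w_def
    by (rule nheads_conf) (use tc in \<open>auto simp: passed_def\<close>)
  have "steps w (conf N t 0 (code c) (replicate r Rt @ [Hlt]))"
    using run_code[OF assms(1,2), of "[]"] by (simp add: w_def)
  also have "steps \<dots> (conf N t r ?u [Hlt])"
    using run_Rts[OF tc, of 0 r N t "[Hlt]"] assms(3) by simp
  also have "step \<dots> (?l @ Ptr # rcells t r N @ ?u @ GHlt # [Hlt])"
    by (rule step_rr'[of F Hlt "[GHlt, Hlt]" _ "?l @ Ptr # rcells t r N @ ?u"])
      (auto simp: rr_def conf_def)
  also have "steps \<dots> (?l @ Ptr # GHlt # rcells t r N @ ?u @ [Hlt])"
    by (rule return_left) (use u in auto)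
  also have "step \<dots> (?l @ TH # ?r)"
    by (rule step_ll'[of Ptr GHlt "[TH, Ptr]" _ ?l]) (auto simp: ll_def go_def)
  finally have run: "steps w (?l @ TH # ?r)" .
  show ?thesis
  proof
    assume "t r = 0"
    obtain l a where l: "lcells t r = l @ [a]" "a \<in> {Border, Hash}" using lcells_last by blast
    have "step (?l @ TH # ?r) (l @ [Acc] @ ?r)"
      by (rule step_ll'[of a TH "[Acc]" _ l])
        (use l \<open>t r = 0\<close> in \<open>auto simp: ll_def heads_def\<close>)
    then show "\<exists>l r. steps w (l @ [Acc] @ r)" using run by (meson rtranclp.rtrancl_into_rtrancl)
  next
    assume "\<exists>l r. steps w (l @ [Acc] @ r)"
    then obtain l' r' where acc: "steps w (l' @ [Acc] @ r')" by blast
    show "t r = 0"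
    proof (rule ccontr)
      assume "t r \<noteq> 0"
      then obtain m where m: "t r = Suc m" by (cases "t r") auto
      have eq: "?l @ TH # ?r = (lcells t r @ replicate m One) @ One # TH # ?r"
        by (simp add: m replicate_app_Cons_same)
      have run': "steps w ((lcells t r @ replicate m One) @ One # TH # ?r)"
        using run unfolding eq .
      have "(lcells t r @ replicate m One) @ One # TH # ?r = l' @ [Acc] @ r'"
      proof (rule steps_terminal_unique[OF run' acc n])
        show "\<not> step ((lcells t r @ replicate m One) @ One # TH # ?r) x" for x
          using steps_nheads[OF run'] n by (intro TH_terminal) simp
        show "\<not> step (l' @ [Acc] @ r') x" for x
          using steps_nheads[OF acc] n by (intro Acc_terminal) simp_all
      qed
      moreover have "nheads ((lcells t r @ replicate m One) @ One # TH # ?r) = 1"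
        using steps_nheads[OF run'] n by simp
      ultimately have "TH = Acc"
        using head_unique[of "lcells t r @ replicate m One @ [One]" TH ?r l' Acc r']
        by (simp add: heads_def)
      then show False by simp
    qed
  qed
qed

section \<open>Codes of input words\<close>

lemma letter_code_less: "letter_code c < 6"
  by (cases c) auto

lemma letter_code_inj: "letter_code c = letter_code d \<Longrightarrow> c = d"
  by (cases c; cases d) auto

lemma word_code_inj: "word_code v = word_code w \<Longrightarrow> v = w"
proof (induction v arbitrary: w)
  case Nil
  then show ?case by (cases w) auto
next
  case (Cons c v)
  then obtain d u where w: "w = d # u" by (cases w) auto
  have "(letter_code c + 6 * word_code v) = (letter_code d + 6 * word_code u)"
    using Cons(2) w by simp
  then have "letter_code c = letter_code d \<and> word_code v = word_code u"
    using letter_code_less[of c] letter_code_less[of d] by presburger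
  then show ?case using Cons(1) letter_code_inj w by blast
qed

text \<open>Prepending a fixed word is therefore an affine map on codes, which primitive recursion
  computes.\<close>

lemma word_code_append: "word_code (v @ w) = word_code v + 6 ^ length v * word_code w"
  by (induction v) (auto simp: algebra_simps)

section \<open>Recursive functions that assemble codes of words\<close>

fun add_rec :: "nat \<Rightarrow> recf \<Rightarrow> recf" where
  "add_rec 0 f = f" | "add_rec (Suc a) f = Comp Sf [add_rec a f]"

lemma reval_add_rec: "reval f xs y \<Longrightarrow> reval (add_rec a f) xs (a + y)"
proof (induction a)
  case (Suc a)
  have "reval (Comp Sf [add_rec a f]) xs (Suc (a + y))"
    by (rule reval.comp[where vs = "[a + y]"]) (use Suc in \<open>auto intro: reval.succ\<close>)
  then show ?case by simp
qed simp

definition affine_rec :: "nat \<Rightarrow> nat \<Rightarrow> recf" where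
  "affine_rec a b = Prim (add_rec a Zf) (add_rec b (Proj 0))"

lemma reval_affine_rec: "reval (affine_rec a b) (z # xs) (a + b * z)"
proof (induction z)
  case 0
  show ?case unfolding affine_rec_def
    using reval_add_rec[OF reval.zero, of a xs] by (auto intro: reval.prim0)
next
  case (Suc z)
  have "reval (add_rec b (Proj 0)) ((a + b * z) # z # xs) (b + (a + b * z))"
    by (rule reval_add_rec) (use reval.proj[of 0 "(a + b * z) # z # xs"] in simp)
  from reval.primS[OF Suc[unfolded affine_rec_def] this] show ?case
    unfolding affine_rec_def by (simp add: algebra_simps)
qed

fun repeat :: "nat \<Rightarrow> 'a list \<Rightarrow> 'a list" where
  "repeat 0 w = []" | "repeat (Suc m) w = w @ repeat m w"

definition repeat_rec :: "letter list \<Rightarrow> recf" where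
  "repeat_rec v = Prim (Proj 0) (Comp (affine_rec (word_code v) (6 ^ length v)) [Proj 0])"

lemma reval_repeat_rec:
  "reval (repeat_rec v) [m, word_code u] (word_code (repeat m v @ u))"
proof (induction m)
  case 0
  show ?case unfolding repeat_rec_def
    using reval.proj[of 0 "[word_code u]"] by (auto intro: reval.prim0)
next
  case (Suc m)
  let ?w = "word_code (repeat m v @ u)"
  have "reval (Comp (affine_rec (word_code v) (6 ^ length v)) [Proj 0]) [?w, m, word_code u]
      (word_code v + 6 ^ length v * ?w)"
    by (rule reval.comp[where vs = "[?w]"])
      (use reval.proj[of 0 "[?w, m, word_code u]"] reval_affine_rec in auto)
  from reval.primS[OF Suc[unfolded repeat_rec_def] this] show ?case
    unfolding repeat_rec_def by (simp add: word_code_append)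
qed

text \<open>The argument is used twice, as the number of copies of \<open>v\<close> and as the code
  of the tail; this is the self-application of the diagonal argument.\<close>

definition input_rec :: "letter list \<Rightarrow> letter list \<Rightarrow> recf" where
  "input_rec p v = Comp (affine_rec (word_code p) (6 ^ length p))
     [Comp (repeat_rec v) [Proj 0, Proj 0]]"

lemma reval_input_rec:
  assumes "x = word_code u"
  shows "reval (input_rec p v) [x] (word_code (p @ repeat x v @ u))"
proof -
  let ?w = "word_code (repeat x v @ u)"
  have "reval (Comp (repeat_rec v) [Proj 0, Proj 0]) [x] ?w"
    by (rule reval.comp[where vs = "[x, x]"])
      (use reval.proj[of 0 "[x]"] reval_repeat_rec[of v x u] assms in auto)
  then show ?thesis unfolding input_rec_def word_code_append[of p]
    by (intro reval.comp[where vs = "[?w]"]) (auto intro: reval_affine_rec)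
qed

text \<open>The order of quantifiers is essential: \<open>u\<close> depends on \<open>g\<close>
  alone, so that \<open>x\<close> may afterwards be chosen as the code of \<open>u\<close>.\<close>

lemma undecidable_if_universal:
  assumes M: "\<And>w. word_code w \<in> M \<longleftrightarrow> w \<in> W"
    and W: "\<And>g. \<exists>u. \<forall>x y. reval g [x] y \<longrightarrow> (p @ repeat x v @ u \<in> W \<longleftrightarrow> y = 0)"
  shows "\<not> decidable_set M"
proof
  assume "decidable_set M"
  then obtain f where f: "\<And>x. reval f [x] (if x \<in> M then 1 else 0)"
    unfolding decidable_set_def by blast
  define g where "g = Comp f [input_rec p v]"
  obtain u where u: "\<And>x y. reval g [x] y \<Longrightarrow> p @ repeat x v @ u \<in> W \<longleftrightarrow> y = 0"
    using W[of g] by blast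
  define x where "x = word_code u"
  define w where "w = p @ repeat x v @ u"
  have "reval g [x] (if word_code w \<in> M then 1 else 0)"
    unfolding g_def w_def
    by (rule reval.comp[where vs = "[word_code (p @ repeat x v @ u)]"])
      (use f reval_input_rec[OF x_def] in auto)
  \<comment> \<open>The returned value is 0 exactly when the word lies outside \<open>M\<close>,
    whereas \<open>u\<close> makes it 0 exactly when the word lies in \<open>W\<close>.\<close>
  from u[OF this] show False unfolding w_def M by (simp split: if_splits)
qed

section \<open>Undecidability for the wreath product\<close>

theorem theorem5:
  fixes n :: nat
  assumes "n \<ge> 2"
  shows "\<exists>r :: letter rexp. \<not> decidable_set (membership_problem n r)"
proof -
  obtain e :: "sym \<Rightarrow> nat" and k where e: "e ` UNIV = {i. i < k}" "inj e"
    using finite_imp_inj_to_nat_seg[OF finite_UNIV_sym] by blast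
  interpret lamp_encoding k e
    by unfold_locales (use e in auto)
  obtain r where r: "lang r = walks rules Acc"
    using regular_walks[OF finite_rules] unfolding regular_def by blast
  define W where "W = {w. wr_eval n w \<in> wr_eval n ` lang r}"
  have W: "puts b \<in> W \<longleftrightarrow> (\<exists>l r. steps b (l @ [Acc] @ r))" for b
    unfolding W_def r using walks_correct[OF assms] by simp
  have puts_append: "puts (a @ b) = puts a @ puts b" for a b
    by (simp add: puts_def)
  have puts_ones: "puts (replicate m One) = repeat m (puts [One])" for m
    by (induction m) (auto simp: puts_def)
  have "\<not> decidable_set (membership_problem n r)"
  proof (rule undecidable_if_universal)
    show "word_code w \<in> membership_problem n r \<longleftrightarrow> w \<in> W" for w
      unfolding membership_problem_def W_def using word_code_inj by auto
    fix g
    \<comment> \<open>The input is in register 0, the result goes to register 1 and scratch space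
      starts at 2; the bound \<open>N\<close> is at least 2 so that register 1 exists.\<close>
    define c where "c = compile g [0] 1 2"
    define N where "N = max 2 (bound c)"
    \<comment> \<open>The part of the initial word behind the unary input: \<open>Ptr\<close> closes
      register 0, and each of the other \<open>N - 1\<close> registers is empty and thus a single
      \<open>Hash\<close>. The final \<open>Rt\<close> moves the pointer to the result.\<close>
    define b where "b = Ptr # replicate (N - 1) Hash @ F # code c @ replicate 1 Rt @ [Hlt]"
    have "puts [Border] @ repeat x (puts [One]) @ puts b \<in> W \<longleftrightarrow> y = 0" if "reval g [x] y" for x y
    proof -
      define s :: "nat \<Rightarrow> nat" where "s = (\<lambda>_. 0)(0 := x)"
      have "concat (map (cell s) xs) = replicate (length xs) Hash" if "0 \<notin> set xs" for xs
        using that by (induction xs) (auto simp: cell_def s_def)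
      from this[of "[Suc 0..<N]"]
      have "concat (map (cell s) [Suc 0..<N]) = replicate (N - 1) Hash" by simp
      then have "conf N s 0 [] (code c @ replicate 1 Rt @ [Hlt]) = [Border] @ replicate x One @ b"
        by (simp add: conf_def lcells_def rcells_def b_def) (simp add: s_def)
      moreover have "exec c s (s(1 := y))"
        unfolding c_def by (rule correctD[OF correct_compile that])
          (auto simp: frame_def s_def)
      ultimately have "(\<exists>l r. steps ([Border] @ replicate x One @ b) (l @ [Acc] @ r)) \<longleftrightarrow> y = 0"
        using machine_accepts_iff[of c s "s(1 := y)" N 1] by (simp add: N_def)
      then show ?thesis unfolding W[symmetric] puts_append puts_ones .
    qed
    then show "\<exists>u. \<forall>x y. reval g [x] y \<longrightarrow>
        (puts [Border] @ repeat x (puts [One]) @ u \<in> W \<longleftrightarrow> y = 0)" by blast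
  qed
  then show ?thesis by blast
qed

end
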